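(* Let $(P_1,\dots,P_n)$ be a quantum integrable system with $P_n=\hat H$, with principal symbol map $F=(f_1,\dots,f_{n-1},f_n=H)$ and joint spectrum $\Sigma_\hbar$. Let $c\in\mathbb{R}^n$ be a regular value of $F$ (in the image of $F$), and assume that the Liouville torus $\Lambda:=F^{-1}(c)$ is connected. Let $\lambda_\hbar$ be a joint eigenvalue in $\Sigma_\hbar$ such that $$\lambda_\hbar=c+\mathcal{O}(\hbar).$$ Let $G_\hbar$ be an asymptotic chart for $\Sigma_\hbar$ in a neighborhood of $c$, let $k=k(\hbar)\in\mathbb{Z}^n$ be the corresponding label for $\lambda_\hbar$, and let $I:=G_0^{-1}\circ F$ be the associated action variables. Then the quantum rotation number satisfies $$[\hat w_\hbar](k)=[w_I](\Lambda)+\mathcal{O}(\hbar).$$ The term $\mathcal{O}(\hbar)$ is relative to the topology of $\mathbb{RP}^{n-1}$, and is uniform if $c$ varies in a compact subset.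
   Context: Quantum integrable system: let $X=\mathbb{R}^n$ or a compact manifold of dimension $n$. If $X=\mathbb{R}^n$, an order function is $m:\mathbb{R}^{2n}\to[1,\infty)$ with $m(Z)\le C\langle Z-Y\rangle^Nm(Y)$ for some $C,N>0$; $S(m)$ is the class of $a(\cdot;\hbar)\in C^\infty(\mathbb{R}^{2n})$, $\hbar\in(0,\hbar_0]$, with $|\partial^\alpha a|\le C_\alpha m$ uniformly in $\hbar$, assumed to admit expansions $a\sim\sum_{j\ge0}\hbar^ja_j$ in $S(m)$; $P\in S(m)$ means $P$ is the $\hbar$-Weyl quantization of such a symbol; $a_0$ is its principal symbol. If $X$ is compact, operators are taken in the semiclassical Kohn–Nirenberg class of order $d$ and $m=\langle\xi\rangle^d$, $S(m):=S^d(X)$. $P$ is elliptic at infinity in $S(m)$ if $P\in S(m)$ and $|a_0|\ge c\,m$ for some $c>0$ and large $(x,\xi)$ (large $\xi$ when $X$ is compact). A quantum integrable system is the data of $n$ commuting selfadjoint operators $P_1,\dots,P_n\in S(m)$ (commuting spectral measures) whose principal symbols $F=(f_1,\dots,f_n)$ form a classical integrable system on $T^*X$ (pairwise Poisson commuting, differentials almost everywhere independent); it is assumed that $F$ is proper and $P_1^2+\cdots+P_n^2$ is elliptic at infinity in $S(m^2)$. The joint spectrum $\Sigma_\hbar\subset\mathbb{R}^n$ is the support of the joint spectral measure; it is discrete for small $\hbar$. Asymptotic lattice: $B\subset\mathbb{R}^n$ simply connected bounded open, $\mathcal{I}\subset(0,\infty)$ accumulating at $0$, $\mathcal{L}_\hbar\subset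 B$ discrete for $\hbar\in\mathcal{I}$. $(\mathcal{L}_\hbar,\mathcal{I},B)$ is an asymptotic lattice if (1) for some $\hbar_0,\epsilon_0>0,N_0\ge1$, distinct points of $\mathcal{L}_\hbar$ are at distance $\ge\epsilon_0\hbar^{N_0}$ for $\hbar\in\mathcal{I}\cap(0,\hbar_0]$; (2) there are a bounded open $U\subset\mathbb{R}^n$ and smooth $G_\hbar:U\to\mathbb{R}^n$ with expansion $G_\hbar=G_0+\hbar G_1+\cdots$ in $C^\infty(U)$, $G_0$ an orientation preserving diffeomorphism from $U$ onto a neighborhood of $\overline B$, and constants $C_N$ such that for all $\hbar\in\mathcal{I}$: (a) each $\lambda\in\mathcal{L}_\hbar$ admits $k\in\mathbb{Z}^n$ with $\hbar k\in U$ and $\|\lambda-G_\hbar(\hbar k)\|\le C_N\hbar^N$ for all $N$ $( * )$; (b) for every open $\tilde U_0\Subset G_0^{-1}(B)$ there is $\tilde\hbar_0>0$ such that for $\hbar\in\mathcal{I}\cap(0,\tilde\hbar_0]$ and $k\in\mathbb{Z}^n$ with $\hbar k\in\tilde U_0$ there is $\lambda\in\mathcal{L}_\hbar$ with $( * )$. $G_\hbar$ is called an asymptotic chart; for small $\hbar$ the integer vector $k=k_\hbar(\lambda)$ in $( * )$ is unique, and the injective map $k_\hbar$ is the good labelling associated with $G_\hbar$. Known fact (Bohr–Sommerfeld rules): for $c$ a regular value of $F$ with connected fiber, there is a ball $B$ around $c$ such that $(\Sigma_\hbar\cap B,(0,\hbar_0],B)$ is an asymptotic lattice, and $F=G_0(I)$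 with $I$ action variables near $F^{-1}(c)$. Action variables and classical rotation number: near a Liouville torus there are symplectic coordinates $(I,\theta)\in\mathbb{R}^n\times(\mathbb{R}/2\pi\mathbb{Z})^n$ with $F$ a local diffeomorphism (with positive Jacobian determinant) of $I$; $H=g(I)$ and $[w_I](\Lambda)=[\partial_1g(I(\Lambda)):\cdots:\partial_ng(I(\Lambda))]\in\mathbb{RP}^{n-1}$. Quantum rotation number: given a good labelling $k_\hbar$ of $\Sigma_\hbar$ in $B$, $\lambda\in\Sigma_\hbar$ in a smaller open set $\tilde B\Subset B$, $k=k_\hbar(\lambda)$, denote by $E_k(\hbar)$ the last component of the joint eigenvalue with label $k$. Then $[\hat w_\hbar](k):=[E_{k+e_1}(\hbar)-E_k(\hbar):\cdots:E_{k+e_n}(\hbar)-E_k(\hbar)]\in\mathbb{RP}^{n-1}$, where $(e_1,\dots,e_n)$ is the canonical basis of $\mathbb{Z}^n$ (well defined for small $\hbar$).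
   Formalization: The expansion of the asymptotic chart G_ħ in C^∞(U) is required with remainder bounds on all derivatives uniform on U; with bounds only on compact subsets of U, the label k in ( * ) need not be unique and the quantum rotation number is undefined. *)

theory Defs
  imports "HOL-Analysis.Analysis" "HOL-Library.Landau_Symbols"
begin

section \<open>Smooth functions on open subsets of Euclidean spaces\<close>

text \<open>A list of basis vectors encodes a partial derivative of arbitrary order.\<close>

primrec iter_deriv ::
  "'a list \<Rightarrow> ('a::real_normed_vector \<Rightarrow> 'b::real_normed_vector) \<Rightarrow> 'a \<Rightarrow> 'b" where
  "iter_deriv [] f = f"
| "iter_deriv (v # vs) f = (\<lambda>x. frechet_derivative (iter_deriv vs f) (at x) v)"

text \<open>Only meant for open \<open>S\<close>.\<close>

definition smooth_on :: "'a::euclidean_space set \<Rightarrow> ('a \<Rightarrow> 'b::real_normed_vector) \<Rightarrow> bool" where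
  "smooth_on S f \<longleftrightarrow> (\<forall>vs\<in>lists Basis. \<forall>x\<in>S. iter_deriv vs f differentiable (at x))"

definition japanese :: "'a::real_normed_vector \<Rightarrow> real" where
  "japanese z = sqrt (1 + (norm z)\<^sup>2)"

definition schwartz :: "('a::euclidean_space \<Rightarrow> complex) set" where
  "schwartz = {u. smooth_on UNIV u \<and>
     (\<forall>N::nat. \<forall>vs\<in>lists Basis. \<exists>C. \<forall>x. japanese x ^ N * norm (iter_deriv vs u x) \<le> C)}"


section \<open>Manifolds and their cotangent bundles\<close>

type_synonym ('x, 'n) chart = "'x set \<times> ('x \<Rightarrow> (real, 'n) vec)"
type_synonym ('x, 'n) atlas = "('x, 'n) chart set"

definition chart_inv :: "('x, 'n::finite) chart \<Rightarrow> real^'n \<Rightarrow> 'x" where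
  "chart_inv c = inv_into (fst c) (snd c)"

definition smooth_atlas :: "('x::topological_space, 'n::finite) atlas \<Rightarrow> bool" where
  "smooth_atlas \<A> \<longleftrightarrow>
     (\<Union>c\<in>\<A>. fst c) = UNIV \<and>
     (\<forall>c\<in>\<A>. open (fst c) \<and> open (snd c ` fst c) \<and>
        homeomorphism (fst c) (snd c ` fst c) (snd c) (chart_inv c)) \<and>
     (\<forall>c\<in>\<A>. \<forall>d\<in>\<A>. smooth_on (snd c ` (fst c \<inter> fst d)) (snd d \<circ> chart_inv c))"

text \<open>The case \<open>X = \<real>\<^sup>n\<close>: a single global chart identifies the space with \<open>\<real>\<^sup>n\<close>.\<close>

definition euclidean_atlas :: "('x::topological_space, 'n::finite) atlas \<Rightarrow> bool" where
  "euclidean_atlas \<A> \<longleftrightarrow> (\<exists>\<kappa>. \<A> = {(UNIV, \<kappa>)} \<and> homeomorphism UNIV UNIV \<kappa> (inv \<kappa>))"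

text \<open>A measure that has a smooth positive density in every chart.\<close>

definition smooth_density :: "('x::topological_space, 'n::finite) atlas \<Rightarrow> 'x measure \<Rightarrow> bool" where
  "smooth_density \<A> \<mu> \<longleftrightarrow> sets \<mu> = sets borel \<and>
     (\<forall>c\<in>\<A>. \<exists>\<rho>::real^'n \<Rightarrow> real.
        smooth_on (snd c ` fst c) \<rho> \<and> (\<forall>y\<in>snd c ` fst c. 0 < \<rho> y) \<and>
        (\<forall>A\<in>sets borel. A \<subseteq> fst c \<longrightarrow>
           emeasure \<mu> A = (\<integral>\<^sup>+y\<in>snd c ` A. ennreal (\<rho> y) \<partial>lborel)))"

definition smooth_functions :: "('x, 'n::finite) atlas \<Rightarrow> ('x \<Rightarrow> complex) set" where
  "smooth_functions \<A> = {u. \<forall>c\<in>\<A>. smooth_on (snd c ` fst c) (u \<circ> chart_inv c)}"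

definition fun_support :: "('x::topological_space \<Rightarrow> complex) \<Rightarrow> 'x set" where
  "fun_support u = closure {x. u x \<noteq> 0}"

text \<open>A covector at \<open>x\<close> is represented by the family of its components in all charts around
  \<open>x\<close> (and \<open>0\<close> for the other charts); the components have to obey the
  transformation law of differential forms.\<close>

type_synonym ('x, 'n) phase_point = "'x \<times> (('x, 'n) chart \<Rightarrow> (real, 'n) vec)"

definition cotangent :: "('x, 'n::finite) atlas \<Rightarrow> ('x, 'n) phase_point set" where
  "cotangent \<A> = {(x, \<xi>).
     (\<forall>c\<in>\<A>. \<forall>d\<in>\<A>. x \<in> fst c \<inter> fst d \<longrightarrow>
        (\<forall>v. \<xi> c \<bullet> v = \<xi> d \<bullet> frechet_derivative (snd d \<circ> chart_inv c) (at (snd c x)) v)) \<and>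
     (\<forall>c. \<not> (c \<in> \<A> \<and> x \<in> fst c) \<longrightarrow> \<xi> c = 0)}"

definition ct_dom :: "('x, 'n::finite) atlas \<Rightarrow> ('x, 'n) chart \<Rightarrow> ('x, 'n) phase_point set" where
  "ct_dom \<A> c = {p \<in> cotangent \<A>. fst p \<in> fst c}"

definition ct_chart :: "('x, 'n::finite) chart \<Rightarrow> ('x, 'n) phase_point \<Rightarrow> (real^'n) \<times> (real^'n)" where
  "ct_chart c p = (snd c (fst p), snd p c)"

definition ct_inv ::
  "('x, 'n::finite) atlas \<Rightarrow> ('x, 'n) chart \<Rightarrow> (real^'n) \<times> (real^'n) \<Rightarrow> ('x, 'n) phase_point" where
  "ct_inv \<A> c = inv_into (ct_dom \<A> c) (ct_chart c)"

definition ct_topology :: "('x, 'n::finite) atlas \<Rightarrow> ('x, 'n) phase_point topology" where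
  "ct_topology \<A> = topology_generated_by
     {{p \<in> ct_dom \<A> c. ct_chart c p \<in> W} | c W. c \<in> \<A> \<and> open W}"


section \<open>Classical integrable systems on the cotangent bundle\<close>

definition ct_smooth ::
  "('x, 'n::finite) atlas \<Rightarrow> (('x, 'n) phase_point \<Rightarrow> 'b::real_normed_vector) \<Rightarrow> bool" where
  "ct_smooth \<A> f \<longleftrightarrow> (\<forall>c\<in>\<A>. smooth_on ((snd c ` fst c) \<times> UNIV) (f \<circ> ct_inv \<A> c))"

text \<open>The differential at \<open>p\<close> read in the cotangent chart of \<open>c\<close>.\<close>

definition ct_differential ::
  "('x, 'n::finite) atlas \<Rightarrow> ('x, 'n) chart \<Rightarrow> (('x, 'n) phase_point \<Rightarrow> 'b::real_normed_vector) \<Rightarrow>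
   ('x, 'n) phase_point \<Rightarrow> (real^'n) \<times> (real^'n) \<Rightarrow> 'b" where
  "ct_differential \<A> c f p = frechet_derivative (f \<circ> ct_inv \<A> c) (at (ct_chart c p))"

definition poisson_bracket ::
  "('x, 'n::finite) atlas \<Rightarrow> ('x, 'n) chart \<Rightarrow> (('x, 'n) phase_point \<Rightarrow> real) \<Rightarrow>
   (('x, 'n) phase_point \<Rightarrow> real) \<Rightarrow> ('x, 'n) phase_point \<Rightarrow> real" where
  "poisson_bracket \<A> c f g p = (\<Sum>i\<in>UNIV.
     ct_differential \<A> c f p (0, axis i 1) * ct_differential \<A> c g p (axis i 1, 0)
   - ct_differential \<A> c f p (axis i 1, 0) * ct_differential \<A> c g p (0, axis i 1))"

definition independent_differentials ::
  "('x, 'n::finite) atlas \<Rightarrow> ('x, 'n) chart \<Rightarrow> (('x, 'n) phase_point \<Rightarrow> real^'n) \<Rightarrow>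
   ('x, 'n) phase_point \<Rightarrow> bool" where
  "independent_differentials \<A> c F p \<longleftrightarrow>
     (\<forall>t::'n \<Rightarrow> real. (\<forall>v. (\<Sum>j\<in>UNIV. t j * ct_differential \<A> c (\<lambda>q. F q $ j) p v) = 0) \<longrightarrow>
        (\<forall>j. t j = 0))"

definition classical_integrable_system ::
  "('x, 'n::finite) atlas \<Rightarrow> (('x, 'n) phase_point \<Rightarrow> real^'n) \<Rightarrow> bool" where
  "classical_integrable_system \<A> F \<longleftrightarrow>
     ct_smooth \<A> F \<and>
     (\<forall>i j. \<forall>c\<in>\<A>. \<forall>p\<in>ct_dom \<A> c.
        poisson_bracket \<A> c (\<lambda>q. F q $ i) (\<lambda>q. F q $ j) p = 0) \<and>
     (\<forall>c\<in>\<A>. negligible (ct_chart c ` {p \<in> ct_dom \<A> c. \<not> independent_differentials \<A> c F p}))"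

definition fiber ::
  "('x, 'n::finite) atlas \<Rightarrow> (('x, 'n) phase_point \<Rightarrow> real^'n) \<Rightarrow> real^'n \<Rightarrow> ('x, 'n) phase_point set" where
  "fiber \<A> F c = {p \<in> cotangent \<A>. F p = c}"

definition regular_value ::
  "('x, 'n::finite) atlas \<Rightarrow> (('x, 'n) phase_point \<Rightarrow> real^'n) \<Rightarrow> real^'n \<Rightarrow> bool" where
  "regular_value \<A> F c \<longleftrightarrow>
     (\<forall>d\<in>\<A>. \<forall>p\<in>fiber \<A> F c \<inter> ct_dom \<A> d. surj (ct_differential \<A> d F p))"


section \<open>Unbounded operators and spectral measures on \<open>L\<^sup>2\<close>\<close>

text \<open>Elements of \<open>L\<^sup>2\<close> are represented by functions, equality being equality almost everywhere.
  An unbounded operator is given by its graph, a set of pairs of such functions.\<close>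

definition L2 :: "'x measure \<Rightarrow> ('x \<Rightarrow> complex) set" where
  "L2 \<mu> = {u \<in> borel_measurable \<mu>. integrable \<mu> (\<lambda>x. (cmod (u x))\<^sup>2)}"

definition L2_inner :: "'x measure \<Rightarrow> ('x \<Rightarrow> complex) \<Rightarrow> ('x \<Rightarrow> complex) \<Rightarrow> complex" where
  "L2_inner \<mu> u v = (\<integral>x. cnj (u x) * v x \<partial>\<mu>)"

type_synonym 'x operator = "(('x \<Rightarrow> complex) \<times> ('x \<Rightarrow> complex)) set"

text \<open>Dense domain and \<open>A = A\<^sup>*\<close>.\<close>

definition selfadjoint :: "'x measure \<Rightarrow> 'x operator \<Rightarrow> bool" where
  "selfadjoint \<mu> A \<longleftrightarrow>
     (\<forall>u\<in>L2 \<mu>. \<forall>\<epsilon>>0. \<exists>x\<in>Domain A. (\<integral>s. (cmod (u s - x s))\<^sup>2 \<partial>\<mu>) < \<epsilon>) \<and>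
     A = {(u, v). u \<in> L2 \<mu> \<and> v \<in> L2 \<mu> \<and> (\<forall>(x, y)\<in>A. L2_inner \<mu> u y = L2_inner \<mu> v x)}"

text \<open>Projection-valued Borel measures.\<close>

definition pvm ::
  "'x measure \<Rightarrow> ('b::topological_space set \<Rightarrow> ('x \<Rightarrow> complex) \<Rightarrow> 'x \<Rightarrow> complex) \<Rightarrow> bool" where
  "pvm \<mu> E \<longleftrightarrow>
     (\<forall>S\<in>sets borel. \<forall>u\<in>L2 \<mu>. E S u \<in> L2 \<mu> \<and> (AE x in \<mu>. E S (E S u) x = E S u x)) \<and>
     (\<forall>S\<in>sets borel. \<forall>u\<in>L2 \<mu>. \<forall>v\<in>L2 \<mu>. L2_inner \<mu> (E S u) v = L2_inner \<mu> u (E S v)) \<and>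
     (\<forall>u\<in>L2 \<mu>. AE x in \<mu>. E UNIV u x = u x) \<and>
     (\<forall>S. range S \<subseteq> sets borel \<and> disjoint_family S \<longrightarrow>
        (\<forall>u\<in>L2 \<mu>. \<forall>v\<in>L2 \<mu>.
           (\<lambda>i::nat. L2_inner \<mu> u (E (S i) v)) sums L2_inner \<mu> u (E (\<Union>i. S i) v)))"

definition scalar_spectral_measure ::
  "'x measure \<Rightarrow> ('b::topological_space set \<Rightarrow> ('x \<Rightarrow> complex) \<Rightarrow> 'x \<Rightarrow> complex) \<Rightarrow>
   ('x \<Rightarrow> complex) \<Rightarrow> 'b measure" where
  "scalar_spectral_measure \<mu> E u =
     measure_of UNIV (sets borel) (\<lambda>S. ennreal (Re (L2_inner \<mu> u (E S u))))"

text \<open>\<open>A = \<integral> t dE(t)\<close>: the domain consists of the \<open>u\<close> with finite second moment, and on it the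
  quadratic form of \<open>A\<close>, which determines \<open>A\<close> by polarization, is the first moment.\<close>

definition spectral_measure ::
  "'x measure \<Rightarrow> 'x operator \<Rightarrow> (real set \<Rightarrow> ('x \<Rightarrow> complex) \<Rightarrow> 'x \<Rightarrow> complex) \<Rightarrow> bool" where
  "spectral_measure \<mu> A E \<longleftrightarrow> pvm \<mu> E \<and>
     Domain A = {u \<in> L2 \<mu>. integrable (scalar_spectral_measure \<mu> E u) (\<lambda>t. t\<^sup>2)} \<and>
     (\<forall>(u, v)\<in>A. L2_inner \<mu> u v = complex_of_real (\<integral>t. t \<partial>scalar_spectral_measure \<mu> E u))"

definition strongly_commute :: "'x measure \<Rightarrow> 'x operator \<Rightarrow> 'x operator \<Rightarrow> bool" where
  "strongly_commute \<mu> A B \<longleftrightarrow>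
     (\<exists>E E'. spectral_measure \<mu> A E \<and> spectral_measure \<mu> B E' \<and>
        (\<forall>S\<in>sets borel. \<forall>S'\<in>sets borel. \<forall>u\<in>L2 \<mu>.
           AE x in \<mu>. E S (E' S' u) x = E' S' (E S u) x))"

text \<open>The projection-valued measure on \<open>\<real>\<^sup>n\<close> whose marginals are the individual spectral measures.\<close>

definition joint_spectral_measure ::
  "'x measure \<Rightarrow> ('n::finite \<Rightarrow> 'x operator) \<Rightarrow>
   ((real^'n) set \<Rightarrow> ('x \<Rightarrow> complex) \<Rightarrow> 'x \<Rightarrow> complex) \<Rightarrow> bool" where
  "joint_spectral_measure \<mu> A E \<longleftrightarrow> pvm \<mu> E \<and>
     (\<forall>j. spectral_measure \<mu> (A j) (\<lambda>S. E {t. t $ j \<in> S}))"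

definition joint_spectrum :: "'x measure \<Rightarrow> ('n::finite \<Rightarrow> 'x operator) \<Rightarrow> (real^'n) set" where
  "joint_spectrum \<mu> A = {t. \<exists>E. joint_spectral_measure \<mu> A E \<and>
     (\<forall>W. open W \<and> t \<in> W \<longrightarrow> (\<exists>u\<in>L2 \<mu>. \<not> (AE x in \<mu>. E W u x = 0)))}"

definition sum_of_squares :: "('n::finite \<Rightarrow> 'x operator) \<Rightarrow> 'x operator" where
  "sum_of_squares A = {(u, \<lambda>x. \<Sum>j\<in>UNIV. w j x) | u w.
     \<exists>v. \<forall>j. (u, v j) \<in> A j \<and> (v j, w j) \<in> A j}"


section \<open>Semiclassical pseudodifferential operators\<close>

definition order_function :: "('a::real_normed_vector \<Rightarrow> real) \<Rightarrow> bool" where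
  "order_function m \<longleftrightarrow> (\<forall>z. 1 \<le> m z) \<and>
     (\<exists>C>0. \<exists>N::real>0. \<forall>z y. m z \<le> C * japanese (z - y) powr N * m y)"

text \<open>\<open>Order_function m\<close> stands for the class \<open>S(m)\<close> on \<open>X = \<real>\<^sup>n\<close>, and \<open>Kohn_Nirenberg d\<close> for the
  class \<open>S\<^sup>d(X)\<close> on a compact manifold \<open>X\<close>.\<close>

datatype 'n symbol_order =
    Order_function "(real, 'n::finite) vec \<times> (real, 'n) vec \<Rightarrow> real"
  | Kohn_Nirenberg real

fun square_order :: "'n::finite symbol_order \<Rightarrow> 'n symbol_order" where
  "square_order (Order_function m) = Order_function (\<lambda>z. (m z)\<^sup>2)"
| "square_order (Kohn_Nirenberg d) = Kohn_Nirenberg (2 * d)"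

text \<open>The weight bounding the derivative \<open>iter_deriv vs\<close> of a symbol; in the Kohn-Nirenberg case
  each derivative in \<open>\<xi>\<close> gains one order.\<close>

fun symbol_weight ::
  "'n::finite symbol_order \<Rightarrow> ((real^'n) \<times> (real^'n)) list \<Rightarrow> (real^'n) \<times> (real^'n) \<Rightarrow> real" where
  "symbol_weight (Order_function m) vs z = m z"
| "symbol_weight (Kohn_Nirenberg d) vs z =
     japanese (snd z) powr (d - real (length (filter (\<lambda>v. snd v \<noteq> 0) vs)))"

text \<open>\<open>classical_symbol s h\<^sub>0 a b\<close>: the family \<open>a(\<cdot>;h)\<close>, \<open>0 < h \<le> h\<^sub>0\<close>, lies in the class \<open>s\<close> uniformly
  and \<open>a \<sim> \<Sum>\<^sub>j h\<^sup>j b\<^sub>j\<close> there (the case \<open>N = 0\<close> of the second bound is \<open>a \<in> S(m)\<close> itself).\<close>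

definition classical_symbol ::
  "'n::finite symbol_order \<Rightarrow> real \<Rightarrow> (real \<Rightarrow> (real^'n) \<times> (real^'n) \<Rightarrow> complex) \<Rightarrow>
   (nat \<Rightarrow> (real^'n) \<times> (real^'n) \<Rightarrow> complex) \<Rightarrow> bool" where
  "classical_symbol s h\<^sub>0 a b \<longleftrightarrow>
     (\<forall>h\<in>{0<..h\<^sub>0}. smooth_on UNIV (a h)) \<and> (\<forall>j. smooth_on UNIV (b j)) \<and>
     (\<forall>j. \<forall>vs\<in>lists Basis. \<exists>C. \<forall>z. cmod (iter_deriv vs (b j) z) \<le> C * symbol_weight s vs z) \<and>
     (\<forall>N. \<forall>vs\<in>lists Basis. \<exists>C. \<forall>h\<in>{0<..h\<^sub>0}. \<forall>z.
        cmod (iter_deriv vs (\<lambda>z. a h z - (\<Sum>j<N. complex_of_real (h ^ j) * b j z)) z)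
          \<le> C * h ^ N * symbol_weight s vs z)"

text \<open>For \<open>u\<close> in the Schwartz space the inner integral is rapidly decreasing in \<open>\<xi>\<close>, so that this
  iterated integral is the usual oscillatory integral.\<close>

definition weyl ::
  "real \<Rightarrow> ((real^'n::finite) \<times> (real^'n) \<Rightarrow> complex) \<Rightarrow> (real^'n \<Rightarrow> complex) \<Rightarrow> real^'n \<Rightarrow> complex" where
  "weyl h a u x = complex_of_real (1 / (2 * pi * h) ^ CARD('n)) *
     (\<integral>\<xi>. (\<integral>y. exp (\<i> * complex_of_real (((x - y) \<bullet> \<xi>) / h)) * a ((x + y) /\<^sub>R 2, \<xi>) * u y \<partial>lborel) \<partial>lborel)"

text \<open>Families of smooth kernels on \<open>X \<times> X\<close> that are \<open>O(h\<^sup>\<infinity>)\<close> with all derivatives.\<close>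

definition negligible_kernel ::
  "('x, 'n::finite) atlas \<Rightarrow> real \<Rightarrow> (real \<Rightarrow> 'x \<Rightarrow> 'x \<Rightarrow> complex) \<Rightarrow> bool" where
  "negligible_kernel \<A> h\<^sub>0 K \<longleftrightarrow> (\<forall>c\<in>\<A>. \<forall>d\<in>\<A>.
     (let D = (snd c ` fst c) \<times> (snd d ` fst d);
          k = (\<lambda>h z. K h (chart_inv c (fst z)) (chart_inv d (snd z)))
      in (\<forall>h\<in>{0<..h\<^sub>0}. smooth_on D (k h)) \<and>
         (\<forall>N. \<forall>vs\<in>lists Basis. \<forall>Q. compact Q \<and> Q \<subseteq> D \<longrightarrow>
            (\<exists>C. \<forall>h\<in>{0<..h\<^sub>0}. \<forall>z\<in>Q. cmod (iter_deriv vs (k h) z) \<le> C * h ^ N))))"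

text \<open>\<open>pseudodiff \<A> \<mu> s h\<^sub>0 P p\<close>: the family of operators \<open>P h\<close> is in the class \<open>s\<close>, with principal
  symbol \<open>p\<close>. On \<open>\<real>\<^sup>n\<close> the operator \<open>P h\<close> is defined on the Schwartz space and is there the Weyl
  quantization of a symbol. On a compact manifold it preserves \<open>C\<^sup>\<infinity>(X)\<close>; localized by cutoffs in a
  chart it is the Weyl quantization of a symbol on \<open>\<real>\<^sup>2\<^sup>n\<close>, and localized by cutoffs with disjoint
  supports it is smoothing and \<open>O(h\<^sup>\<infinity>)\<close>.\<close>

fun pseudodiff ::
  "('x::topological_space, 'n::finite) atlas \<Rightarrow> 'x measure \<Rightarrow> 'n symbol_order \<Rightarrow> real \<Rightarrow>
   (real \<Rightarrow> 'x operator) \<Rightarrow> (('x, 'n) phase_point \<Rightarrow> complex) \<Rightarrow> bool" where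
  "pseudodiff \<A> \<mu> (Order_function m) h\<^sub>0 P p \<longleftrightarrow>
     (\<forall>c\<in>\<A>. \<exists>a b. classical_symbol (Order_function m) h\<^sub>0 a b \<and>
        (\<forall>z. b 0 z = p (ct_inv \<A> c z)) \<and>
        (\<forall>h\<in>{0<..h\<^sub>0}. \<forall>u\<in>schwartz. (u \<circ> snd c, weyl h (a h) u \<circ> snd c) \<in> P h))"
| "pseudodiff \<A> \<mu> (Kohn_Nirenberg d) h\<^sub>0 P p \<longleftrightarrow>
     (\<forall>h\<in>{0<..h\<^sub>0}. \<forall>u\<in>smooth_functions \<A>. \<exists>v\<in>smooth_functions \<A>. (u, v) \<in> P h) \<and>
     (\<forall>c\<in>\<A>. \<forall>\<phi>\<in>smooth_functions \<A>. \<forall>\<psi>\<in>smooth_functions \<A>.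
        fun_support \<phi> \<subseteq> fst c \<and> fun_support \<psi> \<subseteq> fst c \<longrightarrow>
        (\<exists>a b. classical_symbol (Kohn_Nirenberg d) h\<^sub>0 a b \<and>
           (\<forall>y \<eta>. b 0 (y, \<eta>) = (if y \<in> snd c ` fst c
              then \<phi> (chart_inv c y) * \<psi> (chart_inv c y) * p (ct_inv \<A> c (y, \<eta>)) else 0)) \<and>
           (\<forall>h\<in>{0<..h\<^sub>0}. \<forall>u\<in>schwartz. \<forall>v.
              (\<lambda>x. if x \<in> fst c then \<psi> x * u (snd c x) else 0, v) \<in> P h \<longrightarrow>
              (AE y in lborel. weyl h (a h) u y =
                 (if y \<in> snd c ` fst c then \<phi> (chart_inv c y) * v (chart_inv c y) else 0))))) \<and>
     (\<forall>\<phi>\<in>smooth_functions \<A>. \<forall>\<psi>\<in>smooth_functions \<A>.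
        fun_support \<phi> \<inter> fun_support \<psi> = {} \<longrightarrow>
        (\<exists>K. negligible_kernel \<A> h\<^sub>0 K \<and>
           (\<forall>h\<in>{0<..h\<^sub>0}. \<forall>u\<in>smooth_functions \<A>. \<forall>v. (\<lambda>x. \<psi> x * u x, v) \<in> P h \<longrightarrow>
              (AE x in \<mu>. \<phi> x * v x = (\<integral>y. K h x y * u y \<partial>\<mu>)))))"

fun elliptic_at_infinity ::
  "('x::topological_space, 'n::finite) atlas \<Rightarrow> 'x measure \<Rightarrow> 'n symbol_order \<Rightarrow> real \<Rightarrow>
   (real \<Rightarrow> 'x operator) \<Rightarrow> bool" where
  "elliptic_at_infinity \<A> \<mu> (Order_function m) h\<^sub>0 P \<longleftrightarrow>
     (\<exists>p. pseudodiff \<A> \<mu> (Order_function m) h\<^sub>0 P p \<and>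
        (\<forall>c\<in>\<A>. \<exists>\<epsilon>>0. \<exists>R. \<forall>z. R \<le> norm z \<longrightarrow> \<epsilon> * m z \<le> cmod (p (ct_inv \<A> c z))))"
| "elliptic_at_infinity \<A> \<mu> (Kohn_Nirenberg d) h\<^sub>0 P \<longleftrightarrow>
     (\<exists>p. pseudodiff \<A> \<mu> (Kohn_Nirenberg d) h\<^sub>0 P p \<and>
        (\<forall>c\<in>\<A>. \<forall>Q. compact Q \<and> Q \<subseteq> snd c ` fst c \<longrightarrow>
           (\<exists>\<epsilon>>0. \<exists>R. \<forall>y\<in>Q. \<forall>\<eta>. R \<le> norm \<eta> \<longrightarrow>
              \<epsilon> * japanese \<eta> powr d \<le> cmod (p (ct_inv \<A> c (y, \<eta>))))))"


section \<open>Quantum integrable systems\<close>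

fun admissible_space ::
  "('x::topological_space, 'n::finite) atlas \<Rightarrow> 'x measure \<Rightarrow> 'n symbol_order \<Rightarrow> bool" where
  "admissible_space \<A> \<mu> (Order_function m) \<longleftrightarrow>
     order_function m \<and> euclidean_atlas \<A> \<and>
     (\<forall>c\<in>\<A>. \<mu> = distr lborel borel (chart_inv c))"
| "admissible_space \<A> \<mu> (Kohn_Nirenberg d) \<longleftrightarrow>
     compact (UNIV :: 'x set) \<and> smooth_atlas \<A> \<and> smooth_density \<A> \<mu>"

definition quantum_integrable_system ::
  "('x::topological_space, 'n::finite) atlas \<Rightarrow> 'x measure \<Rightarrow> 'n symbol_order \<Rightarrow> real \<Rightarrow>
   (real \<Rightarrow> 'n \<Rightarrow> 'x operator) \<Rightarrow> (('x, 'n) phase_point \<Rightarrow> real^'n) \<Rightarrow> bool" where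
  "quantum_integrable_system \<A> \<mu> s h\<^sub>0 P F \<longleftrightarrow>
     0 < h\<^sub>0 \<and> admissible_space \<A> \<mu> s \<and>
     (\<forall>h\<in>{0<..h\<^sub>0}. (\<forall>j. selfadjoint \<mu> (P h j)) \<and> (\<forall>i j. strongly_commute \<mu> (P h i) (P h j))) \<and>
     (\<forall>j. pseudodiff \<A> \<mu> s h\<^sub>0 (\<lambda>h. P h j) (\<lambda>p. complex_of_real (F p $ j))) \<and>
     classical_integrable_system \<A> F \<and>
     proper_map (ct_topology \<A>) euclidean F \<and>
     elliptic_at_infinity \<A> \<mu> (square_order s) h\<^sub>0 (\<lambda>h. sum_of_squares (P h))"


section \<open>Asymptotic lattices and good labellings\<close>

definition scaled :: "real \<Rightarrow> int^'n::finite \<Rightarrow> real^'n" where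
  "scaled h k = (\<chi> i. h * real_of_int (k $ i))"

text \<open>The condition \<open>(*)\<close> relating a lattice point to its label.\<close>

definition is_label ::
  "(real^'n::finite) set \<Rightarrow> (real \<Rightarrow> real^'n \<Rightarrow> real^'n) \<Rightarrow> (nat \<Rightarrow> real) \<Rightarrow> real \<Rightarrow> real^'n \<Rightarrow> int^'n \<Rightarrow> bool"
  where
  "is_label U G C h t k \<longleftrightarrow> scaled h k \<in> U \<and> (\<forall>N. norm (t - G h (scaled h k)) \<le> C N * h ^ N)"

text \<open>The asymptotic expansion holds in \<open>C\<^sup>\<infinity>(U)\<close> for all derivatives uniformly on \<open>U\<close>. With mere
  locally uniform control nothing would be known on \<open>G h\<close> near the boundary of \<open>U\<close>, and the label
  of a lattice point would in general not be unique.\<close>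

definition smooth_expansion ::
  "real set \<Rightarrow> (real^'n::finite) set \<Rightarrow> (real \<Rightarrow> real^'n \<Rightarrow> real^'n) \<Rightarrow> (nat \<Rightarrow> real^'n \<Rightarrow> real^'n) \<Rightarrow> bool"
  where
  "smooth_expansion \<I> U G g \<longleftrightarrow>
     (\<forall>h\<in>\<I>. smooth_on U (G h)) \<and> (\<forall>j. smooth_on U (g j)) \<and>
     (\<forall>N. \<forall>vs\<in>lists Basis. \<exists>C. \<exists>h\<^sub>1>0. \<forall>h\<in>\<I> \<inter> {0<..h\<^sub>1}. \<forall>x\<in>U.
        norm (iter_deriv vs (\<lambda>x. G h x - (\<Sum>j\<le>N. h ^ j *\<^sub>R g j x)) x) \<le> C * h ^ Suc N)"

definition oriented_diffeo :: "(real^'n::finite) set \<Rightarrow> (real^'n \<Rightarrow> real^'n) \<Rightarrow> bool" where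
  "oriented_diffeo U f \<longleftrightarrow>
     open U \<and> open (f ` U) \<and> inj_on f U \<and> smooth_on U f \<and> smooth_on (f ` U) (inv_into U f) \<and>
     (\<forall>x\<in>U. 0 < det (matrix (frechet_derivative f (at x))))"

definition asymptotic_chart ::
  "(real \<Rightarrow> (real^'n::finite) set) \<Rightarrow> real set \<Rightarrow> (real^'n) set \<Rightarrow> (real^'n) set \<Rightarrow>
   (real \<Rightarrow> real^'n \<Rightarrow> real^'n) \<Rightarrow> (real^'n \<Rightarrow> real^'n) \<Rightarrow> (nat \<Rightarrow> real) \<Rightarrow> bool" where
  "asymptotic_chart L \<I> B U G G\<^sub>0 C \<longleftrightarrow>
     open U \<and> bounded U \<and>
     (\<exists>g. g 0 = G\<^sub>0 \<and> smooth_expansion \<I> U G g) \<and>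
     oriented_diffeo U G\<^sub>0 \<and> closure B \<subseteq> G\<^sub>0 ` U \<and>
     (\<forall>h\<in>\<I>. \<forall>t\<in>L h. \<exists>k. is_label U G C h t k) \<and>
     (\<forall>V. open V \<and> compact (closure V) \<and> closure V \<subseteq> {x \<in> U. G\<^sub>0 x \<in> B} \<longrightarrow>
        (\<exists>h\<^sub>1>0. \<forall>h\<in>\<I> \<inter> {0<..h\<^sub>1}. \<forall>k. scaled h k \<in> V \<longrightarrow> (\<exists>t\<in>L h. is_label U G C h t k)))"

definition asymptotic_lattice ::
  "(real \<Rightarrow> (real^'n::finite) set) \<Rightarrow> real set \<Rightarrow> (real^'n) set \<Rightarrow> bool" where
  "asymptotic_lattice L \<I> B \<longleftrightarrow>
     open B \<and> bounded B \<and> simply_connected B \<and>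
     \<I> \<subseteq> {0<..} \<and> 0 islimpt \<I> \<and>
     (\<forall>h\<in>\<I>. L h \<subseteq> B \<and> discrete (L h)) \<and>
     (\<exists>h\<^sub>1>0. \<exists>\<epsilon>>0. \<exists>N::nat. 1 \<le> N \<and>
        (\<forall>h\<in>\<I> \<inter> {0<..h\<^sub>1}. \<forall>s\<in>L h. \<forall>t\<in>L h. s \<noteq> t \<longrightarrow> \<epsilon> * h ^ N \<le> dist s t)) \<and>
     (\<exists>U G G\<^sub>0 C. asymptotic_chart L \<I> B U G G\<^sub>0 C)"

definition good_label ::
  "(real^'n::finite) set \<Rightarrow> (real \<Rightarrow> real^'n \<Rightarrow> real^'n) \<Rightarrow> (nat \<Rightarrow> real) \<Rightarrow> real \<Rightarrow> real^'n \<Rightarrow> int^'n"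
  where
  "good_label U G C h t = (THE k. is_label U G C h t k)"


section \<open>Rotation numbers\<close>

text \<open>Points of \<open>\<real>P\<^sup>n\<^sup>-\<^sup>1\<close> are the lines spanned by nonzero vectors. The metric is the quotient of the
  chordal one on the unit sphere; it is Lipschitz equivalent to any Riemannian distance.\<close>

definition proj_point :: "real^'n::finite \<Rightarrow> (real^'n) set" where
  "proj_point v = span {v}"

definition proj_space :: "(real^'n::finite) set set" where
  "proj_space = {proj_point v | v. v \<noteq> 0}"

definition proj_dist :: "(real^'n::finite) set \<Rightarrow> (real^'n) set \<Rightarrow> real" where
  "proj_dist L L' = Inf {dist u v | u v. u \<in> L \<and> v \<in> L' \<and> norm u = 1 \<and> norm v = 1}"

text \<open>\<open>[\<partial>\<^sub>1 g(I(\<Lambda>)) : \<dots> : \<partial>\<^sub>n g(I(\<Lambda>))]\<close>, where \<open>H = g(I)\<close> near \<open>\<Lambda>\<close>.\<close>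

definition classical_rotation_number ::
  "('x, 'n::finite) atlas \<Rightarrow> (('x, 'n) phase_point \<Rightarrow> real) \<Rightarrow> (('x, 'n) phase_point \<Rightarrow> real^'n) \<Rightarrow>
   ('x, 'n) phase_point set \<Rightarrow> (real^'n) set" where
  "classical_rotation_number \<A> H I \<Lambda> = (THE w. \<exists>g W V.
     openin (ct_topology \<A>) W \<and> \<Lambda> \<subseteq> W \<and> open V \<and> I ` W \<subseteq> V \<and> smooth_on V g \<and>
     (\<forall>p\<in>W. H p = g (I p)) \<and>
     w = proj_point (\<chi> j. frechet_derivative g (at (the_elem (I ` \<Lambda>))) (axis j 1)))"

definition last_index :: "'n::{finite,linorder}" where
  "last_index = Max UNIV"

text \<open>The last component \<open>E\<^sub>k(h)\<close> of the lattice point with label \<open>k\<close>.\<close>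

definition labelled_eigenvalue ::
  "(real \<Rightarrow> (real, 'n::{finite,linorder}) vec set) \<Rightarrow> (real, 'n) vec set \<Rightarrow> (real \<Rightarrow> (real, 'n) vec \<Rightarrow> (real, 'n) vec) \<Rightarrow>
   (nat \<Rightarrow> real) \<Rightarrow> real \<Rightarrow> (int, 'n) vec \<Rightarrow> real" where
  "labelled_eigenvalue L U G C h k = the_inv_into (L h) (good_label U G C h) k $ last_index"

definition quantum_rotation_number ::
  "(real \<Rightarrow> (real, 'n::{finite,linorder}) vec set) \<Rightarrow> (real, 'n) vec set \<Rightarrow> (real \<Rightarrow> (real, 'n) vec \<Rightarrow> (real, 'n) vec) \<Rightarrow>
   (nat \<Rightarrow> real) \<Rightarrow> real \<Rightarrow> (int, 'n) vec \<Rightarrow> (real, 'n) vec set" where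
  "quantum_rotation_number L U G C h k = proj_point (\<chi> j.
     labelled_eigenvalue L U G C h (k + axis j 1) - labelled_eigenvalue L U G C h k)"

end

theory Submission
  imports Defs
begin

text \<open>Both rotation numbers are directions of vectors attached to the principal part \<open>G\<^sub>0\<close> of the
  asymptotic chart, and the theorem compares these vectors. Let \<open>a = G\<^sub>0\<^sup>-\<^sup>1(c)\<close> and let \<open>w\<close> be the
  last row of the Jacobian matrix of \<open>G\<^sub>0\<close> at \<open>a\<close>, which does not vanish because \<open>G\<^sub>0\<close> is a
  diffeomorphism.

  On the classical side, \<open>I = G\<^sub>0\<^sup>-\<^sup>1 \<circ> F\<close> and \<open>H = g \<circ> I\<close> with \<open>g\<close> the last component of \<open>G\<^sub>0\<close>, so the
  frequency vector is \<open>w\<close>. The definition allows any function \<open>g\<close> with \<open>H = g \<circ> I\<close> near the torus,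
  and one has to see that all of them have the same gradient at \<open>a\<close>. This follows from the chain rule,
  as \<open>F\<close> is a submersion along the fiber of a regular value; properness of \<open>F\<close> turns a neighbourhood
  of the torus into a neighbourhood of \<open>c\<close> in the base (\<open>classical_rotation_number_eq\<close>).

  On the quantum side, the joint eigenvalue \<open>t\<close> with label \<open>k\<close> is \<open>G\<^sub>h(hk)\<close> up to \<open>O(h\<^sup>2)\<close>, and the one
  with label \<open>k + e\<^sub>j\<close> is \<open>G\<^sub>h(hk + h e\<^sub>j)\<close> up to \<open>O(h\<^sup>2)\<close>. Since \<open>G\<^sub>h - G\<^sub>0\<close> is \<open>O(h)\<close> with its first
  derivatives and \<open>hk\<close> is within \<open>O(h)\<close> of \<open>a\<close>, Taylor's formula shows that the difference of the
  eigenvalues is \<open>h \<partial>\<^sub>jG\<^sub>0(a) + O(h\<^sup>2)\<close> (\<open>lattice_increments\<close>). Hence the vector of the differences of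
  the last components is \<open>h w + O(h\<^sup>2)\<close>, and its direction is that of \<open>w\<close> up to \<open>O(h)\<close>.

  This presupposes that labels determine joint eigenvalues and conversely, on the whole lattice and
  not only near \<open>c\<close>, since the eigenvalue with a given label is found by inverting the good labelling.
  Uniqueness of labels comes from the closure of \<open>B\<close> being a compact subset of the image of \<open>G\<^sub>0\<close>
  (\<open>label_localization_and_uniqueness\<close>), and injectivity from the separation of the lattice
  (\<open>good_label_bijective\<close>). All estimates are uniform for \<open>c\<close> in a compact set.\<close>

section \<open>Calculus of smooth maps\<close>

lemma smooth_on_has_derivative:
  assumes "smooth_on S f" "x \<in> S"
  shows "(f has_derivative frechet_derivative f (at x)) (at x)"
proof -
  have "iter_deriv [] f differentiable (at x)"
    using assms unfolding smooth_on_def by (metis lists.Nil)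
  then show ?thesis
    by (simp add: frechet_derivative_works)
qed

lemma smooth_on_continuous_on: "smooth_on S f \<Longrightarrow> continuous_on S f"
  using smooth_on_has_derivative
  by (metis continuous_at_imp_continuous_on has_derivative_continuous)

lemma smooth_on_iter_deriv:
  assumes "smooth_on S f" "vs \<in> lists Basis"
  shows "smooth_on S (iter_deriv vs f)"
proof -
  have append: "iter_deriv ws (iter_deriv vs f) = iter_deriv (ws @ vs) f" for ws
    by (induction ws) auto
  show ?thesis
    using assms unfolding smooth_on_def append by (metis append_in_lists_conv)
qed

lemma smooth_on_frechet_derivative:
  assumes "smooth_on S f" "b \<in> Basis"
  shows "smooth_on S (\<lambda>x. frechet_derivative f (at x) b)"
  using smooth_on_iter_deriv[OF assms(1), of "[b]"] assms(2) by simp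

lemma smooth_on_ident: "smooth_on S (\<lambda>x. x)"
proof -
  have "\<exists>c. iter_deriv vs (\<lambda>x::'a. x) = (\<lambda>x. x) \<or> iter_deriv vs (\<lambda>x::'a. x) = (\<lambda>_. c)" for vs
  proof (induction vs)
    case (Cons v vs)
    then obtain c where "iter_deriv vs (\<lambda>x::'a. x) = (\<lambda>x. x) \<or> iter_deriv vs (\<lambda>x::'a. x) = (\<lambda>_. c)"
      by blast
    then show ?case
      by auto
  qed auto
  then show ?thesis
    unfolding smooth_on_def by (metis differentiable_const differentiable_ident)
qed

lemma smooth_on_bounded_linear_image:
  assumes "open S" "bounded_linear T" "smooth_on S f"
  shows "smooth_on S (\<lambda>x. T (f x))"
proof -
  have deriv: "((\<lambda>x. T (iter_deriv vs f x)) has_derivative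
      (\<lambda>v. T (frechet_derivative (iter_deriv vs f) (at x) v))) (at x)"
    if "vs \<in> lists Basis" "x \<in> S" for vs x
    using smooth_on_has_derivative[OF smooth_on_iter_deriv[OF assms(3) that(1)] that(2)]
    by (rule bounded_linear.has_derivative[OF assms(2)])
  have comm: "\<forall>x\<in>S. iter_deriv vs (\<lambda>x. T (f x)) x = T (iter_deriv vs f x)"
    if "vs \<in> lists Basis" for vs
    using that
  proof (induction vs)
    case (Cons v vs)
    show ?case
    proof
      fix x assume "x \<in> S"
      have "(iter_deriv vs (\<lambda>x. T (f x)) has_derivative
          (\<lambda>v. T (frechet_derivative (iter_deriv vs f) (at x) v))) (at x)"
        by (rule has_derivative_transform_within_open[OF deriv assms(1) \<open>x \<in> S\<close>])
          (use Cons \<open>x \<in> S\<close> in auto)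
      from frechet_derivative_at[OF this]
      show "iter_deriv (v # vs) (\<lambda>x. T (f x)) x = T (iter_deriv (v # vs) f x)"
        by (simp add: fun_eq_iff)
    qed
  qed simp
  have "(iter_deriv vs (\<lambda>x. T (f x)) has_derivative
      (\<lambda>v. T (frechet_derivative (iter_deriv vs f) (at x) v))) (at x)"
    if "vs \<in> lists Basis" "x \<in> S" for vs x
    by (rule has_derivative_transform_within_open[OF deriv assms(1) \<open>x \<in> S\<close>])
      (use comm that in auto)
  then show ?thesis
    unfolding smooth_on_def differentiable_def by blast
qed

lemma frechet_derivative_component:
  assumes "smooth_on S f" "x \<in> S"
  shows "frechet_derivative (\<lambda>x. f x $ i) (at x) v = frechet_derivative f (at x) v $ i"
  using frechet_derivative_at[OF
      bounded_linear.has_derivative[OF bounded_linear_vec_nth smooth_on_has_derivative[OF assms]]]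
  by (simp add: fun_eq_iff)

text \<open>The mean value inequality in the form in which \<open>smooth_on\<close> and \<open>smooth_expansion\<close> provide
  its hypothesis, namely through derivatives along basis vectors.\<close>

lemma norm_diff_le_of_partial_bounds:
  fixes f :: "'a::euclidean_space \<Rightarrow> 'b::real_normed_vector"
  assumes "convex S"
    and der: "\<And>x. x \<in> S \<Longrightarrow> (f has_derivative f' x) (at x)"
    and bound: "\<And>x b. x \<in> S \<Longrightarrow> b \<in> Basis \<Longrightarrow> norm (f' x b) \<le> M b"
    and "x \<in> S" "y \<in> S"
  shows "norm (f x - f y) \<le> (\<Sum>b\<in>Basis. M b) * norm (x - y)"
proof (rule differentiable_bound[OF assms(1) _ _ assms(4,5)])
  show "(f has_derivative f' x) (at x within S)" if "x \<in> S" for x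
    using der[OF that] by (rule has_derivative_at_withinI)
  show "onorm (f' x) \<le> (\<Sum>b\<in>Basis. M b)" if "x \<in> S" for x
  proof (rule onorm_le)
    fix v
    interpret bounded_linear "f' x"
      using der[OF that] by (rule has_derivative_bounded_linear)
    have "f' x v = (\<Sum>b\<in>Basis. (v \<bullet> b) *\<^sub>R f' x b)"
      by (metis (no_types, lifting) euclidean_representation scaleR sum sum.cong)
    also have "norm \<dots> \<le> (\<Sum>b\<in>Basis. norm v * M b)"
    proof (rule sum_norm_le)
      fix b :: 'a assume "b \<in> Basis"
      then show "norm ((v \<bullet> b) *\<^sub>R f' x b) \<le> norm v * M b"
        using Basis_le_norm[of b v] bound[OF that, of b] by (auto intro!: mult_mono)
    qed
    finally show "norm (f' x v) \<le> (\<Sum>b\<in>Basis. M b) * norm v"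
      by (simp add: sum_distrib_left mult.commute)
  qed
qed

text \<open>A compact set need not be convex, so a smooth map is Lipschitz only along the convex subsets
  of it; the constant does not depend on the subset.\<close>

lemma smooth_on_Lipschitz_compact:
  fixes f :: "'a::euclidean_space \<Rightarrow> 'b::real_normed_vector"
  assumes "smooth_on U f" "compact N" "N \<subseteq> U"
  obtains D where "0 \<le> D"
    "\<And>S x y. \<lbrakk>convex S; S \<subseteq> N; x \<in> S; y \<in> S\<rbrakk> \<Longrightarrow> norm (f x - f y) \<le> D * norm (x - y)"
proof -
  have "\<exists>M\<ge>0. \<forall>x\<in>N. norm (frechet_derivative f (at x) b) \<le> M" if "b \<in> Basis" for b
  proof -
    have "continuous_on N (\<lambda>x. frechet_derivative f (at x) b)"
      using smooth_on_continuous_on[OF smooth_on_frechet_derivative[OF assms(1) that]] assms(3)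
      by (rule continuous_on_subset)
    then have "bounded ((\<lambda>x. frechet_derivative f (at x) b) ` N)"
      using assms(2) by (intro compact_imp_bounded compact_continuous_image)
    then show ?thesis
      unfolding bounded_pos by (metis imageI less_imp_le)
  qed
  then obtain M where M: "\<And>b. b \<in> Basis \<Longrightarrow> 0 \<le> M b"
    "\<And>b x. b \<in> Basis \<Longrightarrow> x \<in> N \<Longrightarrow> norm (frechet_derivative f (at x) b) \<le> M b"
    by metis
  show thesis
  proof (rule that)
    show "0 \<le> (\<Sum>b\<in>Basis. M b)"
      using M(1) by (rule sum_nonneg)
    show "norm (f x - f y) \<le> (\<Sum>b\<in>Basis. M b) * norm (x - y)"
      if "convex S" "S \<subseteq> N" "x \<in> S" "y \<in> S" for S x y
      using that(1) _ _ that(3,4)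
    proof (rule norm_diff_le_of_partial_bounds)
      show "(f has_derivative frechet_derivative f (at x)) (at x)" if "x \<in> S" for x
        using smooth_on_has_derivative[OF assms(1)] assms(3) \<open>S \<subseteq> N\<close> that by blast
    qed (use M(2) that(2) in blast)
  qed
qed

text \<open>The estimate compares increments with the differential at the centre of a ball that contains
  both end points. It is the previous lemma for the first derivatives, inserted into the mean value
  inequality for the difference of the map and its differential.\<close>

lemma smooth_on_linearization_compact:
  fixes f :: "'a::euclidean_space \<Rightarrow> 'b::real_normed_vector"
  assumes "smooth_on U f" "compact N" "N \<subseteq> U"
  obtains D where "0 \<le> D"
    "\<And>a s x y. \<lbrakk>cball a s \<subseteq> N; x \<in> cball a s; y \<in> cball a s\<rbrakk> \<Longrightarrow>
       norm (f x - f y - frechet_derivative f (at a) (x - y)) \<le> D * s * norm (x - y)"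
proof -
  have "\<exists>D\<ge>0. \<forall>S x y. convex S \<and> S \<subseteq> N \<and> x \<in> S \<and> y \<in> S \<longrightarrow>
      norm (frechet_derivative f (at x) b - frechet_derivative f (at y) b) \<le> D * norm (x - y)"
    if "b \<in> Basis" for b
    using smooth_on_Lipschitz_compact[OF smooth_on_frechet_derivative[OF assms(1) that] assms(2,3)]
    by metis
  then obtain D where D0: "\<And>b. b \<in> Basis \<Longrightarrow> 0 \<le> D b"
    and D: "\<And>b S x y. \<lbrakk>b \<in> Basis; convex S; S \<subseteq> N; x \<in> S; y \<in> S\<rbrakk> \<Longrightarrow>
      norm (frechet_derivative f (at x) b - frechet_derivative f (at y) b) \<le> D b * norm (x - y)"
    by metis
  show thesis
  proof (rule that)
    show "0 \<le> (\<Sum>b\<in>Basis. D b)"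
      using D0 by (rule sum_nonneg)
    fix a s x y
    assume ball: "cball a s \<subseteq> N" and x: "x \<in> cball a s" and y: "y \<in> cball a s"
    have "0 \<le> s"
      using x zero_le_dist[of a x] by (simp del: zero_le_dist)
    then have a: "a \<in> cball a s"
      by simp
    let ?T = "frechet_derivative f (at a)"
    have der: "(f has_derivative frechet_derivative f (at z)) (at z)" if "z \<in> cball a s" for z
      using smooth_on_has_derivative[OF assms(1)] assms(3) ball that by blast
    have "bounded_linear ?T"
      using der[OF a] by (rule has_derivative_bounded_linear)
    then have lin: "?T (x - y) = ?T x - ?T y" and
      derT: "(?T has_derivative ?T) (at z)" for z
      by (auto simp: linear_simps intro: bounded_linear_imp_has_derivative)
    have "norm ((f x - ?T x) - (f y - ?T y)) \<le> (\<Sum>b\<in>Basis. D b * s) * norm (x - y)"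
    proof (rule norm_diff_le_of_partial_bounds[OF convex_cball _ _ x y])
      fix z assume z: "z \<in> cball a s"
      show "((\<lambda>z. f z - ?T z) has_derivative (\<lambda>v. frechet_derivative f (at z) v - ?T v)) (at z)"
        using der[OF z] derT by (rule has_derivative_diff)
      fix b :: 'a assume b: "b \<in> Basis"
      have "norm (frechet_derivative f (at z) b - ?T b) \<le> D b * norm (z - a)"
        using D[OF b convex_cball ball z a] .
      also have "\<dots> \<le> D b * s"
        using z D0[OF b] by (intro mult_left_mono) (auto simp: dist_norm norm_minus_commute)
      finally show "norm (frechet_derivative f (at z) b - ?T b) \<le> D b * s" .
    qed
    moreover have "f x - f y - ?T (x - y) = (f x - ?T x) - (f y - ?T y)"
      by (simp add: lin)
    ultimately show "norm (f x - f y - ?T (x - y)) \<le> (\<Sum>b\<in>Basis. D b) * s * norm (x - y)"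
      by (simp only: sum_distrib_right)
  qed
qed

lemma compact_thickening:
  fixes K :: "'a::euclidean_space set"
  assumes "compact K" "open U" "K \<subseteq> U"
  obtains r where "0 < r" "compact (\<Union>x\<in>K. cball x r)" "(\<Union>x\<in>K. cball x r) \<subseteq> U"
proof -
  obtain r where r: "0 < r" "(\<Union>x\<in>K. cball x r) \<subseteq> U"
    using compact_subset_open_imp_cball_epsilon_subset[OF assms] .
  have "(\<Union>x\<in>K. cball x r) = {x + y | x y. x \<in> K \<and> y \<in> cball 0 r}"
  proof (intro set_eqI iffI)
    fix z assume "z \<in> (\<Union>x\<in>K. cball x r)"
    then obtain x where "x \<in> K" "z - x \<in> cball 0 r" "z = x + (z - x)"
      by (auto simp: dist_norm norm_minus_commute)
    then show "z \<in> {x + y | x y. x \<in> K \<and> y \<in> cball 0 r}"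
      by blast
  next
    fix z assume "z \<in> {x + y | x y. x \<in> K \<and> y \<in> cball 0 r}"
    then obtain x y where "x \<in> K" "norm y \<le> r" "z = x + y"
      by auto
    then show "z \<in> (\<Union>x\<in>K. cball x r)"
      by (intro UN_I[of x]) (auto simp: dist_norm)
  qed
  then have "compact (\<Union>x\<in>K. cball x r)"
    using compact_sums[OF assms(1) compact_cball[of 0 r]] by simp
  with r that show thesis
    by blast
qed

section \<open>The classical rotation number\<close>

lemma smooth_atlas_of_admissible_space:
  assumes "admissible_space \<A> \<mu> s"
  shows "smooth_atlas \<A>"
proof (cases s)
  case (Order_function m)
  then obtain \<kappa> where \<A>: "\<A> = {(UNIV, \<kappa>)}" and hom: "homeomorphism UNIV UNIV \<kappa> (inv \<kappa>)"
    using assms by (auto simp: euclidean_atlas_def)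
  have "\<kappa> (inv \<kappa> y) = y" for y
    using hom by (simp add: homeomorphism_def)
  then have "\<kappa> \<circ> inv \<kappa> = (\<lambda>y. y)"
    by auto
  moreover have "range \<kappa> = UNIV"
    using hom by (simp add: homeomorphism_def)
  ultimately show ?thesis
    using hom smooth_on_ident by (simp add: \<A> smooth_atlas_def chart_inv_def)
qed (use assms in simp)

context
  fixes \<A> :: "('x::topological_space, 'n::finite) atlas"
  assumes atlas: "smooth_atlas \<A>"
begin

lemma chart_inv_of_chart: "c \<in> \<A> \<Longrightarrow> x \<in> fst c \<Longrightarrow> chart_inv c (snd c x) = x"
  using atlas by (simp add: smooth_atlas_def homeomorphism_def)

lemma chart_has_ct_dom:
  assumes "p \<in> cotangent \<A>"
  obtains c where "c \<in> \<A>" "p \<in> ct_dom \<A> c"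
proof -
  have "fst p \<in> (\<Union>c\<in>\<A>. fst c)"
    using atlas by (simp add: smooth_atlas_def)
  with assms that show thesis
    by (auto simp: ct_dom_def)
qed

lemma inj_on_ct_chart:
  assumes "c \<in> \<A>"
  shows "inj_on (ct_chart c) (ct_dom \<A> c)"
proof (rule inj_onI)
  fix p q assume p: "p \<in> ct_dom \<A> c" and q: "q \<in> ct_dom \<A> c" and eq: "ct_chart c p = ct_chart c q"
  obtain x \<xi> y \<eta> where [simp]: "p = (x, \<xi>)" "q = (y, \<eta>)"
    by (metis surj_pair)
  have x: "x \<in> fst c" and "y \<in> fst c" and "snd c x = snd c y" and comp: "\<xi> c = \<eta> c"
    using p q eq by (auto simp: ct_dom_def ct_chart_def)
  then have [simp]: "y = x"
    using chart_inv_of_chart[OF assms] by metis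
  have "\<xi> d = \<eta> d" for d
  proof (cases "d \<in> \<A> \<and> x \<in> fst d")
    case True
    have law: "\<zeta> d \<bullet> v = \<zeta> c \<bullet> frechet_derivative (snd c \<circ> chart_inv d) (at (snd d x)) v"
      if "(x, \<zeta>) \<in> cotangent \<A>" for \<zeta> v
      using that True x assms unfolding cotangent_def by blast
    have "\<xi> d \<bullet> v = \<eta> d \<bullet> v" for v
      using p q law[of \<xi> v] law[of \<eta> v] comp by (simp only: ct_dom_def) simp
    then show ?thesis
      using vector_eq_rdot by blast
  next
    case False
    then have zero: "\<zeta> d = 0" if "(x, \<zeta>) \<in> cotangent \<A>" for \<zeta>
      using that unfolding cotangent_def by blast
    show ?thesis
      using p q zero[of \<xi>] zero[of \<eta>] by (simp only: ct_dom_def) simp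
  qed
  then show "p = q"
    by auto
qed

lemma ct_inv_of_ct_chart:
  "c \<in> \<A> \<Longrightarrow> p \<in> ct_dom \<A> c \<Longrightarrow> ct_inv \<A> c (ct_chart c p) = p"
  unfolding ct_inv_def by (rule inv_into_f_f[OF inj_on_ct_chart])

lemma open_chart_overlap:
  assumes "c \<in> \<A>" "d \<in> \<A>"
  shows "open (snd c ` (fst c \<inter> fst d))"
proof -
  have hom: "homeomorphism (fst c) (snd c ` fst c) (snd c) (chart_inv c)"
    and op: "open (snd c ` fst c)" "open (fst d)"
    using atlas assms by (auto simp: smooth_atlas_def)
  have "snd c ` (fst c \<inter> fst d) = snd c ` fst c \<inter> chart_inv c -` fst d"
    using chart_inv_of_chart[OF assms(1)] by (auto simp: rev_image_eqI)
  also have "open \<dots>"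
    using hom op by (intro continuous_open_preimage) (auto simp: homeomorphism_def)
  finally show ?thesis .
qed

lemma transition_has_derivative:
  assumes "c \<in> \<A>" "d \<in> \<A>" "x \<in> fst c" "x \<in> fst d"
  shows "((snd d \<circ> chart_inv c) has_derivative frechet_derivative (snd d \<circ> chart_inv c) (at (snd c x)))
    (at (snd c x))"
  by (rule smooth_on_has_derivative[where S = "snd c ` (fst c \<inter> fst d)"])
    (use atlas assms in \<open>auto simp: smooth_atlas_def\<close>)

lemma transition_derivative_cocycle:
  assumes "c \<in> \<A>" "d \<in> \<A>" "e \<in> \<A>" "x \<in> fst c" "x \<in> fst d" "x \<in> fst e"
  shows "frechet_derivative (snd e \<circ> chart_inv c) (at (snd c x)) v =
    frechet_derivative (snd e \<circ> chart_inv d) (at (snd d x))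
      (frechet_derivative (snd d \<circ> chart_inv c) (at (snd c x)) v)"
proof -
  have x: "(snd d \<circ> chart_inv c) (snd c x) = snd d x"
    using chart_inv_of_chart assms by simp
  have chain: "(((snd e \<circ> chart_inv d) \<circ> (snd d \<circ> chart_inv c)) has_derivative
      frechet_derivative (snd e \<circ> chart_inv d) (at (snd d x)) \<circ>
      frechet_derivative (snd d \<circ> chart_inv c) (at (snd c x))) (at (snd c x))"
    by (rule diff_chain_at) (use transition_has_derivative assms x in auto)
  have "((snd e \<circ> chart_inv c) has_derivative
      frechet_derivative (snd e \<circ> chart_inv d) (at (snd d x)) \<circ>
      frechet_derivative (snd d \<circ> chart_inv c) (at (snd c x))) (at (snd c x))"
    by (rule has_derivative_transform_within_open[OF chain open_chart_overlap[OF assms(1,2)]])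
      (use chart_inv_of_chart[OF assms(1)] chart_inv_of_chart[OF assms(2)] assms in auto)
  from frechet_derivative_at[OF this] show ?thesis
    by (simp add: fun_eq_iff)
qed

text \<open>Every covector over a chart extends to a consistent family of components: they are forced by
  the transformation law, and the cocycle rule for the transition maps makes them consistent.\<close>

lemma ct_chart_surj:
  assumes "c \<in> \<A>" "z \<in> (snd c ` fst c) \<times> UNIV"
  obtains p where "p \<in> ct_dom \<A> c" "ct_chart c p = z"
proof -
  obtain x \<eta> where x: "x \<in> fst c" and z: "z = (snd c x, \<eta>)"
    using assms(2) by auto
  define T where "T d = frechet_derivative (snd c \<circ> chart_inv d) (at (snd d x))" for d :: "('x, 'n) chart"
  define \<xi> where "\<xi> d = (if d \<in> \<A> \<and> x \<in> fst d then adjoint (T d) \<eta> else 0)" for d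
  have \<xi>: "\<xi> d \<bullet> v = \<eta> \<bullet> T d v" if "d \<in> \<A>" "x \<in> fst d" for d v
  proof -
    have "linear (T d)"
      unfolding T_def using transition_has_derivative[OF that(1) assms(1) that(2) x]
      by (metis has_derivative_linear)
    then show ?thesis
      using that adjoint_works[of "T d" v \<eta>] by (simp add: \<xi>_def inner_commute)
  qed
  have "(x, \<xi>) \<in> cotangent \<A>"
    unfolding cotangent_def
  proof (clarsimp, intro conjI ballI impI allI)
    fix d e v assume "d \<in> \<A>" "e \<in> \<A>" and "x \<in> fst d \<and> x \<in> fst e"
    then show "\<xi> d \<bullet> v = \<xi> e \<bullet> frechet_derivative (snd e \<circ> chart_inv d) (at (snd d x)) v"
      using transition_derivative_cocycle[of d e c x v] assms(1) x by (simp add: \<xi> T_def)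
  qed (auto simp: \<xi>_def)
  moreover have "\<xi> c = \<eta>"
  proof -
    have "((\<lambda>y. y) has_derivative (\<lambda>v. v)) (at (snd c x))"
      by simp
    then have "((snd c \<circ> chart_inv c) has_derivative (\<lambda>v. v)) (at (snd c x))"
      by (rule has_derivative_transform_within_open[OF _ open_chart_overlap[OF assms(1) assms(1)]])
        (use chart_inv_of_chart[OF assms(1)] x in auto)
    from frechet_derivative_at[OF this] have "T c v = v" for v
      by (simp add: T_def fun_eq_iff)
    then have "\<xi> c \<bullet> v = \<eta> \<bullet> v" for v
      using \<xi>[OF assms(1) x] by simp
    then show ?thesis
      using vector_eq_rdot by blast
  qed
  ultimately show thesis
    using that[of "(x, \<xi>)"] x by (simp add: ct_dom_def ct_chart_def z)
qed

lemma ct_inv_mem: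
  assumes "c \<in> \<A>" "z \<in> (snd c ` fst c) \<times> UNIV"
  shows "ct_inv \<A> c z \<in> ct_dom \<A> c" "ct_chart c (ct_inv \<A> c z) = z"
  using ct_chart_surj[OF assms] ct_inv_of_ct_chart[OF assms(1)] by metis+

lemma open_ct_chart_range:
  assumes "c \<in> \<A>"
  shows "open ((snd c ` fst c) \<times> (UNIV :: (real^'n) set))"
  using atlas assms by (simp add: smooth_atlas_def open_Times)

lemma ct_chart_mem: "p \<in> ct_dom \<A> c \<Longrightarrow> ct_chart c p \<in> (snd c ` fst c) \<times> UNIV"
  by (simp add: ct_dom_def ct_chart_def)

lemma topspace_ct_topology: "topspace (ct_topology \<A>) = cotangent \<A>"
proof -
  have "\<Union>{{p \<in> ct_dom \<A> c. ct_chart c p \<in> W} | c W. c \<in> \<A> \<and> open W} = cotangent \<A>"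
    (is "?l = _")
  proof (intro equalityI subsetI)
    fix p assume "p \<in> cotangent \<A>"
    then obtain c where "c \<in> \<A>" "p \<in> {p \<in> ct_dom \<A> c. ct_chart c p \<in> UNIV}"
      by (auto elim: chart_has_ct_dom)
    then show "p \<in> ?l"
      using open_UNIV by blast
  qed (auto simp: ct_dom_def)
  then show ?thesis
    by (simp add: ct_topology_def)
qed

lemma ct_smooth_open_vimage:
  fixes F :: "('x, 'n) phase_point \<Rightarrow> real^'n"
  assumes "ct_smooth \<A> F" "open W"
  shows "openin (ct_topology \<A>) {p \<in> cotangent \<A>. F p \<in> W}"
proof -
  define O' where
    "O' c = (snd c ` fst c) \<times> (UNIV :: (real^'n) set) \<inter> (F \<circ> ct_inv \<A> c) -` W" for c
  have "open (O' c)" if "c \<in> \<A>" for c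
    unfolding O'_def using assms that
    by (intro continuous_open_preimage open_ct_chart_range smooth_on_continuous_on)
      (auto simp: ct_smooth_def)
  then have "openin (ct_topology \<A>) {p \<in> ct_dom \<A> c. ct_chart c p \<in> O' c}" if "c \<in> \<A>" for c
    unfolding ct_topology_def using that by (intro topology_generated_by_Basis) blast
  then have "openin (ct_topology \<A>) (\<Union>c\<in>\<A>. {p \<in> ct_dom \<A> c. ct_chart c p \<in> O' c})"
    by blast
  also have "(\<Union>c\<in>\<A>. {p \<in> ct_dom \<A> c. ct_chart c p \<in> O' c}) = {p \<in> cotangent \<A>. F p \<in> W}"
  proof (intro equalityI subsetI)
    fix p assume p: "p \<in> {p \<in> cotangent \<A>. F p \<in> W}"
    then obtain c where c: "c \<in> \<A>" "p \<in> ct_dom \<A> c"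
      by (auto elim: chart_has_ct_dom)
    with ct_inv_of_ct_chart[OF c] ct_chart_mem[OF c(2)] p
    have "p \<in> {p \<in> ct_dom \<A> c. ct_chart c p \<in> O' c}"
      by (simp add: O'_def)
    with c(1) show "p \<in> (\<Union>c\<in>\<A>. {p \<in> ct_dom \<A> c. ct_chart c p \<in> O' c})"
      by blast
  next
    fix p assume "p \<in> (\<Union>c\<in>\<A>. {p \<in> ct_dom \<A> c. ct_chart c p \<in> O' c})"
    then obtain c where c: "c \<in> \<A>" "p \<in> ct_dom \<A> c" and "ct_chart c p \<in> O' c"
      by blast
    with ct_inv_of_ct_chart[OF c] show "p \<in> {p \<in> cotangent \<A>. F p \<in> W}"
      by (simp add: O'_def ct_dom_def)
  qed
  finally show ?thesis .
qed

text \<open>A properness argument: the image of the complement of a neighbourhood \<open>W\<close> of the fiber is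
  closed and misses the value of the fiber, so nearby fibers lie in \<open>W\<close> too.\<close>

lemma fiber_neighbourhood:
  fixes F :: "('x, 'n) phase_point \<Rightarrow> real^'n"
  assumes "proper_map (ct_topology \<A>) euclidean F"
    and "openin (ct_topology \<A>) W" "fiber \<A> F c \<subseteq> W"
  obtains T where "open T" "c \<in> T" "\<And>p. p \<in> cotangent \<A> \<Longrightarrow> F p \<in> T \<Longrightarrow> p \<in> W"
proof -
  have "closedin (ct_topology \<A>) (cotangent \<A> - W)"
    using closedin_diff[OF closedin_topspace assms(2)] by (simp add: topspace_ct_topology)
  then have "closed (F ` (cotangent \<A> - W))"
    using assms(1) by (auto simp: proper_map_def closed_map_def)
  moreover have "c \<notin> F ` (cotangent \<A> - W)"
    using assms(3) by (auto simp: fiber_def)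
  ultimately show thesis
    using that[of "- F ` (cotangent \<A> - W)"] by (auto simp: open_Compl)
qed

text \<open>The description in the definition does not depend on the choice of \<open>g\<close>, although \<open>g\<close> is only
  constrained on the image of \<open>I\<close>: as \<open>F\<close> is a submersion along the fiber, the identity
  \<open>H = g \<circ> G\<^sub>0\<^sup>-\<^sup>1 \<circ> F\<close> determines the differential of \<open>g \<circ> G\<^sub>0\<^sup>-\<^sup>1\<close> at \<open>c\<close>, by the chain
  rule. One admissible choice is the corresponding component of \<open>G\<^sub>0\<close>.\<close>

lemma classical_rotation_number_eq:
  fixes F :: "('x, 'n) phase_point \<Rightarrow> real^'n"
  assumes smooth: "ct_smooth \<A> F" and proper: "proper_map (ct_topology \<A>) euclidean F"
    and diffeo: "oriented_diffeo U G\<^sub>0"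
    and c: "c \<in> G\<^sub>0 ` U" "c \<in> F ` cotangent \<A>" "regular_value \<A> F c"
  shows "classical_rotation_number \<A> (\<lambda>p. F p $ i) (inv_into U G\<^sub>0 \<circ> F) (fiber \<A> F c) =
    proj_point (\<chi> j. frechet_derivative G\<^sub>0 (at (inv_into U G\<^sub>0 c)) (axis j 1) $ i)"
proof -
  let ?\<psi> = "inv_into U G\<^sub>0" and ?\<Lambda> = "fiber \<A> F c"
  let ?a = "?\<psi> c"
  have U: "open U" "open (G\<^sub>0 ` U)" "inj_on G\<^sub>0 U" "smooth_on U G\<^sub>0" "smooth_on (G\<^sub>0 ` U) ?\<psi>"
    using diffeo by (auto simp: oriented_diffeo_def)
  have a: "?a \<in> U" "G\<^sub>0 ?a = c"
    using c(1) by (auto intro: inv_into_into f_inv_into_f)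
  obtain p\<^sub>0 where p\<^sub>0: "p\<^sub>0 \<in> cotangent \<A>" "F p\<^sub>0 = c"
    using c(2) by blast
  then have "(?\<psi> \<circ> F) ` ?\<Lambda> = {?a}"
    by (auto simp: fiber_def)
  then have the_a: "the_elem ((?\<psi> \<circ> F) ` ?\<Lambda>) = ?a"
    by simp
  have G\<^sub>0_comp: "smooth_on U (\<lambda>x. G\<^sub>0 x $ i)"
    using U(1) bounded_linear_vec_nth U(4) by (rule smooth_on_bounded_linear_image)
  have unique: "frechet_derivative g (at ?a) u = frechet_derivative G\<^sub>0 (at ?a) u $ i"
    if W: "openin (ct_topology \<A>) W" "?\<Lambda> \<subseteq> W" and V: "(?\<psi> \<circ> F) ` W \<subseteq> V" "smooth_on V g"
      and g: "\<forall>p\<in>W. F p $ i = g ((?\<psi> \<circ> F) p)" for g W V u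
  proof -
    obtain T where T: "open T" "c \<in> T" "\<And>p. p \<in> cotangent \<A> \<Longrightarrow> F p \<in> T \<Longrightarrow> p \<in> W"
      by (rule fiber_neighbourhood[OF proper W]) blast
    obtain d where d: "d \<in> \<A>" "p\<^sub>0 \<in> ct_dom \<A> d"
      using chart_has_ct_dom p\<^sub>0(1) .
    let ?f = "F \<circ> ct_inv \<A> d" and ?z = "ct_chart d p\<^sub>0" and ?D = "(snd d ` fst d) \<times> (UNIV :: (real^'n) set)"
    let ?f' = "frechet_derivative ?f (at ?z)"
    have f_smooth: "smooth_on ?D ?f"
      using smooth d by (simp add: ct_smooth_def)
    have z: "?z \<in> ?D" "?f ?z = c"
      using ct_chart_mem[OF d(2)] ct_inv_of_ct_chart[OF d] p\<^sub>0 by auto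
    have f': "(?f has_derivative ?f') (at ?z)"
      using smooth_on_has_derivative[OF f_smooth z(1)] .
    have "surj ?f'"
      using c(3) d p\<^sub>0 by (auto simp: regular_value_def fiber_def ct_differential_def)
    have aV: "?a \<in> V"
      using V(1) W(2) p\<^sub>0 by (auto simp: fiber_def)
    let ?g' = "frechet_derivative g (at ?a)" and ?\<psi>' = "frechet_derivative ?\<psi> (at c)"
    let ?G' = "frechet_derivative G\<^sub>0 (at ?a)"
    have g': "(g has_derivative ?g') (at ?a)"
      using smooth_on_has_derivative[OF V(2) aV] .
    have \<psi>': "(?\<psi> has_derivative ?\<psi>') (at c)"
      using smooth_on_has_derivative[OF U(5) c(1)] .
    have G': "(G\<^sub>0 has_derivative ?G') (at ?a)"
      using smooth_on_has_derivative[OF U(4) a(1)] .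
    (* On a neighbourhood of the chosen point of the fiber, g after the action map is a
       component of F. *)
    have chain: "((g \<circ> ?\<psi>) \<circ> ?f has_derivative (?g' \<circ> ?\<psi>') \<circ> ?f') (at ?z)"
      by (intro diff_chain_at f') (use g' \<psi>' z(2) in auto)
    have opT: "open (?D \<inter> ?f -` T)"
      using smooth_on_continuous_on[OF f_smooth] open_ct_chart_range[OF d(1)] T(1)
      by (rule continuous_open_preimage)
    have eqT: "((g \<circ> ?\<psi>) \<circ> ?f) y = ?f y $ i" if "y \<in> ?D \<inter> ?f -` T" for y
      using ct_inv_mem[OF d(1), of y] T(3)[of "ct_inv \<A> d y"] g that by (auto simp: ct_dom_def)
    have "?z \<in> ?D \<inter> ?f -` T"
      using z T(2) by (simp only: Int_iff vimage_eq)
    from has_derivative_transform_within_open[OF chain opT this eqT]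
    have "((\<lambda>y. ?f y $ i) has_derivative (?g' \<circ> ?\<psi>') \<circ> ?f') (at ?z)" .
    moreover have "((\<lambda>y. ?f y $ i) has_derivative (\<lambda>v. ?f' v $ i)) (at ?z)"
      using bounded_linear.has_derivative[OF bounded_linear_vec_nth f'] .
    ultimately have gF': "(?g' \<circ> ?\<psi>') \<circ> ?f' = (\<lambda>v. ?f' v $ i)"
      by (rule has_derivative_unique)
    have gF: "?g' (?\<psi>' w) = w $ i" for w
    proof -
      obtain v where "w = ?f' v"
        using surjD[OF \<open>surj ?f'\<close>] by blast
      then show ?thesis
        using fun_cong[OF gF', of v] by (simp only: comp_apply)
    qed
    have "(?\<psi> \<circ> G\<^sub>0 has_derivative ?\<psi>' \<circ> ?G') (at ?a)"
      by (intro diff_chain_at G') (use \<psi>' a in auto)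
    then have "((\<lambda>x. x) has_derivative ?\<psi>' \<circ> ?G') (at ?a)"
      by (rule has_derivative_transform_within_open[OF _ U(1) a(1)])
        (use U(3) in auto)
    then have "?\<psi>' \<circ> ?G' = (\<lambda>v. v)"
      using has_derivative_ident by (rule has_derivative_unique)
    from fun_cong[OF this, of u] have "?\<psi>' (?G' u) = u"
      by (simp only: comp_apply)
    with gF[of "?G' u"] show ?thesis
      by (simp only:)
  qed
  show ?thesis
    unfolding classical_rotation_number_def the_a
  proof (rule the_equality)
    let ?W = "{p \<in> cotangent \<A>. F p \<in> G\<^sub>0 ` U}"
    have "openin (ct_topology \<A>) ?W"
      using smooth U(2) by (rule ct_smooth_open_vimage)
    moreover have "?\<Lambda> \<subseteq> ?W"
      using c(1) by (auto simp: fiber_def)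
    moreover have "(?\<psi> \<circ> F) ` ?W \<subseteq> U"
      by (auto intro: inv_into_into)
    moreover have "\<forall>p\<in>?W. F p $ i = G\<^sub>0 ((?\<psi> \<circ> F) p) $ i"
      by (auto simp: f_inv_into_f)
    moreover have "proj_point (\<chi> j. frechet_derivative G\<^sub>0 (at ?a) (axis j 1) $ i) =
        proj_point (\<chi> j. frechet_derivative (\<lambda>x. G\<^sub>0 x $ i) (at ?a) (axis j 1))"
      using frechet_derivative_component[OF U(4) a(1), of i] by (simp only:)
    ultimately show "\<exists>g W V. openin (ct_topology \<A>) W \<and> ?\<Lambda> \<subseteq> W \<and> open V \<and> (?\<psi> \<circ> F) ` W \<subseteq> V \<and>
        smooth_on V g \<and> (\<forall>p\<in>W. F p $ i = g ((?\<psi> \<circ> F) p)) \<and>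
        proj_point (\<chi> j. frechet_derivative G\<^sub>0 (at ?a) (axis j 1) $ i) =
        proj_point (\<chi> j. frechet_derivative g (at ?a) (axis j 1))"
      using U(1) G\<^sub>0_comp
      by (intro exI[of _ "\<lambda>x. G\<^sub>0 x $ i"] exI[of _ ?W] exI[of _ U] conjI) assumption+
  next
    fix w
    assume "\<exists>g W V. openin (ct_topology \<A>) W \<and> ?\<Lambda> \<subseteq> W \<and> open V \<and> (?\<psi> \<circ> F) ` W \<subseteq> V \<and>
        smooth_on V g \<and> (\<forall>p\<in>W. F p $ i = g ((?\<psi> \<circ> F) p)) \<and>
        w = proj_point (\<chi> j. frechet_derivative g (at ?a) (axis j 1))"
    then obtain g W V where g: "openin (ct_topology \<A>) W" "?\<Lambda> \<subseteq> W" "(?\<psi> \<circ> F) ` W \<subseteq> V"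
      "smooth_on V g" "\<forall>p\<in>W. F p $ i = g ((?\<psi> \<circ> F) p)"
      and w: "w = proj_point (\<chi> j. frechet_derivative g (at ?a) (axis j 1))"
      by blast
    show "w = proj_point (\<chi> j. frechet_derivative G\<^sub>0 (at ?a) (axis j 1) $ i)"
      unfolding w by (simp only: unique[OF g])
  qed
qed

end

section \<open>Labels in an asymptotic chart\<close>

lemma eventually_at_0_within_iff:
  fixes \<I> :: "real set"
  assumes "\<I> \<subseteq> {0<..}"
  shows "eventually P (at 0 within \<I>) \<longleftrightarrow> (\<exists>h\<^sub>1>0. \<forall>h\<in>\<I> \<inter> {0<..h\<^sub>1}. P h)"
proof
  assume "eventually P (at 0 within \<I>)"
  then obtain d where "d > 0" "\<And>h. h \<in> \<I> \<Longrightarrow> h \<noteq> 0 \<Longrightarrow> dist h 0 < d \<Longrightarrow> P h"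
    by (auto simp: eventually_at)
  then have "\<forall>h\<in>\<I> \<inter> {0<..d / 2}. P h"
    by (auto simp: dist_norm)
  with \<open>d > 0\<close> show "\<exists>h\<^sub>1>0. \<forall>h\<in>\<I> \<inter> {0<..h\<^sub>1}. P h"
    by (intro exI[of _ "d / 2"]) simp
next
  assume "\<exists>h\<^sub>1>0. \<forall>h\<in>\<I> \<inter> {0<..h\<^sub>1}. P h"
  then show "eventually P (at 0 within \<I>)"
    using assms by (fastforce simp: eventually_at dist_norm)
qed

lemma eventually_in_at_0_within: "\<forall>\<^sub>F h in at 0 within \<I>. h \<in> (\<I> :: real set)"
  by (simp add: eventually_at_filter)

lemma eventually_mult_less_at_0:
  fixes r a :: real
  assumes "0 < r"
  shows "\<forall>\<^sub>F h in at 0 within \<I>. a * h < r"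
proof -
  have "((\<lambda>h. a * h) \<longlongrightarrow> a * 0) (at 0 within \<I>)"
    by (intro tendsto_intros)
  then show ?thesis
    using assms by (auto dest: order_tendstoD(2))
qed

text \<open>The bounds on the remainder \<open>G h - g 0\<close> and on its first derivatives make the chart a small
  perturbation of its principal part. The Lipschitz bound is what survives division by the mesh
  size \<open>h\<close>: an \<open>O(h)\<close> bound on the values alone would say nothing about the increments of \<open>G h\<close>
  over a step of length \<open>h\<close>.\<close>

lemma smooth_expansion_remainder:
  assumes "\<I> \<subseteq> {0<..}" "smooth_expansion \<I> U G g"
  obtains A where "0 \<le> A"
    "\<forall>\<^sub>F h in at 0 within \<I>. (\<forall>x\<in>U. norm (G h x - g 0 x) \<le> A * h) \<and>
       (\<forall>S x y. convex S \<and> S \<subseteq> U \<and> x \<in> S \<and> y \<in> S \<longrightarrow>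
          norm ((G h x - g 0 x) - (G h y - g 0 y)) \<le> A * h * norm (x - y))"
proof -
  have smooth: "smooth_on U (g 0)" "\<And>h. h \<in> \<I> \<Longrightarrow> smooth_on U (G h)"
    using assms(2) by (auto simp: smooth_expansion_def)
  have "\<exists>C. \<forall>\<^sub>F h in at 0 within \<I>. \<forall>x\<in>U. norm (iter_deriv vs (\<lambda>x. G h x - g 0 x) x) \<le> C * h"
    if "vs \<in> lists Basis" for vs
  proof -
    have "\<exists>C. \<exists>h\<^sub>1>0. \<forall>h\<in>\<I> \<inter> {0<..h\<^sub>1}. \<forall>x\<in>U.
        norm (iter_deriv vs (\<lambda>x. G h x - (\<Sum>j\<le>0. h ^ j *\<^sub>R g j x)) x) \<le> C * h ^ Suc 0"
      using assms(2)[unfolded smooth_expansion_def, THEN conjunct2, THEN conjunct2] that by blast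
    then show ?thesis
      unfolding eventually_at_0_within_iff[OF assms(1)] by simp
  qed
  then have "\<forall>vs\<in>lists Basis. \<exists>C. \<forall>\<^sub>F h in at 0 within \<I>. \<forall>x\<in>U.
      norm (iter_deriv vs (\<lambda>x. G h x - g 0 x) x) \<le> C * h"
    by (rule ballI)
  from bchoice[OF this] obtain C where C: "\<And>vs. vs \<in> lists Basis \<Longrightarrow>
      \<forall>\<^sub>F h in at 0 within \<I>. \<forall>x\<in>U. norm (iter_deriv vs (\<lambda>x. G h x - g 0 x) x) \<le> C vs * h"
    by blast
  define A where "A = \<bar>C []\<bar> + (\<Sum>b\<in>Basis. \<bar>C [b]\<bar>)"
  have A: "\<bar>C []\<bar> \<le> A" "(\<Sum>b\<in>Basis. \<bar>C [b]\<bar>) \<le> A" "0 \<le> A"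
    by (auto simp: A_def sum_nonneg)
  have "\<forall>\<^sub>F h in at 0 within \<I>. \<forall>b\<in>Basis. \<forall>x\<in>U.
      norm (iter_deriv [b] (\<lambda>x. G h x - g 0 x) x) \<le> C [b] * h"
    by (intro eventually_ball_finite ballI C) auto
  with C[OF lists.Nil] eventually_in_at_0_within
  have "\<forall>\<^sub>F h in at 0 within \<I>. (\<forall>x\<in>U. norm (G h x - g 0 x) \<le> A * h) \<and>
       (\<forall>S x y. convex S \<and> S \<subseteq> U \<and> x \<in> S \<and> y \<in> S \<longrightarrow>
          norm ((G h x - g 0 x) - (G h y - g 0 y)) \<le> A * h * norm (x - y))"
  proof (eventually_elim, intro conjI ballI allI impI)
    case (elim h)
    then have h: "h > 0" "h \<in> \<I>"
      using assms(1) by auto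
    have bound: "C vs * h \<le> \<bar>C vs\<bar> * h" for vs
      using h(1) by (intro mult_right_mono) auto
    show "norm (G h x - g 0 x) \<le> A * h" if "x \<in> U" for x
    proof -
      have "norm (G h x - g 0 x) \<le> C [] * h"
        using elim(1) that by simp
      also have "\<dots> \<le> \<bar>C []\<bar> * h"
        by (rule bound)
      also have "\<dots> \<le> A * h"
        using A(1) h(1) by (intro mult_right_mono) auto
      finally show ?thesis .
    qed
    fix S x y assume S: "convex S \<and> S \<subseteq> U \<and> x \<in> S \<and> y \<in> S"
    let ?R = "\<lambda>x. G h x - g 0 x"
    have "norm (?R x - ?R y) \<le> (\<Sum>b\<in>Basis. \<bar>C [b]\<bar> * h) * norm (x - y)"
    proof (rule norm_diff_le_of_partial_bounds)
      fix z assume "z \<in> S"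
      then have z: "z \<in> U"
        using S by blast
      have der: "(?R has_derivative (\<lambda>v. frechet_derivative (G h) (at z) v - frechet_derivative (g 0) (at z) v)) (at z)"
        using smooth_on_has_derivative[OF smooth(2)[OF h(2)] z] smooth_on_has_derivative[OF smooth(1) z]
        by (rule has_derivative_diff)
      then show "(?R has_derivative frechet_derivative ?R (at z)) (at z)"
        using frechet_derivative_at[OF der] by simp
      show "norm (frechet_derivative ?R (at z) b) \<le> \<bar>C [b]\<bar> * h" if "b \<in> Basis" for b
      proof -
        have "norm (iter_deriv [b] ?R z) \<le> C [b] * h"
          using elim(3) that z by blast
        then show ?thesis
          using bound[of "[b]"] by simp
      qed
    qed (use S in auto)
    also have "\<dots> = (\<Sum>b\<in>Basis. \<bar>C [b]\<bar>) * (h * norm (x - y))"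
      by (simp only: sum_distrib_right[symmetric] mult.assoc)
    also have "\<dots> \<le> A * (h * norm (x - y))"
      using A(2) h(1) by (intro mult_right_mono) auto
    finally show "norm (?R x - ?R y) \<le> A * h * norm (x - y)"
      by (simp add: mult.assoc)
  qed
  with A(3) show thesis
    by (rule that)
qed

lemma scaled_add_axis: "scaled h (k + axis j 1) = scaled h k + h *\<^sub>R axis j 1"
  by (simp add: scaled_def vec_eq_iff axis_def algebra_simps)

lemma scaled_eqI:
  assumes "0 < h" "norm (scaled h k - scaled h l) < h"
  shows "k = l"
proof -
  have "k $ i = l $ i" for i
  proof -
    have "\<bar>h * real_of_int (k $ i - l $ i)\<bar> \<le> norm (scaled h k - scaled h l)"
      using component_le_norm_cart[of "scaled h k - scaled h l" i]
      by (simp add: scaled_def algebra_simps)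
    then have "h * \<bar>real_of_int (k $ i - l $ i)\<bar> < h * 1"
      using assms(2) unfolding abs_mult abs_of_pos[OF assms(1)] by linarith
    then have "\<bar>real_of_int (k $ i - l $ i)\<bar> < 1"
      using assms(1) by (simp only: mult_less_cancel_left_pos)
    then show ?thesis
      by linarith
  qed
  then show ?thesis
    by (simp add: vec_eq_iff)
qed

context
  fixes L :: "real \<Rightarrow> (real^'n::finite) set" and \<I> B U G G\<^sub>0 C
  assumes lattice: "asymptotic_lattice L \<I> B"
    and chart: "asymptotic_chart L \<I> B U G G\<^sub>0 C"
begin

private lemma basic:
  "\<I> \<subseteq> {0<..}" "open B" "bounded B" "\<And>h. h \<in> \<I> \<Longrightarrow> L h \<subseteq> B"
  "open U" "open (G\<^sub>0 ` U)" "inj_on G\<^sub>0 U" "smooth_on U G\<^sub>0" "smooth_on (G\<^sub>0 ` U) (inv_into U G\<^sub>0)"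
  "closure B \<subseteq> G\<^sub>0 ` U" "\<And>x. x \<in> U \<Longrightarrow> 0 < det (matrix (frechet_derivative G\<^sub>0 (at x)))"
proof -
  have "\<forall>h\<in>\<I>. L h \<subseteq> B \<and> discrete (L h)"
    using lattice unfolding asymptotic_lattice_def by (elim conjE)
  then show "h \<in> \<I> \<Longrightarrow> L h \<subseteq> B" for h
    by blast
  show "\<I> \<subseteq> {0<..}" "open B" "bounded B"
    using lattice unfolding asymptotic_lattice_def by - (elim conjE, assumption)+
  have diffeo: "oriented_diffeo U G\<^sub>0" and "closure B \<subseteq> G\<^sub>0 ` U"
    using chart unfolding asymptotic_chart_def by - (elim conjE, assumption)+
  then show "closure B \<subseteq> G\<^sub>0 ` U"
    by simp
  show "open U" "open (G\<^sub>0 ` U)" "inj_on G\<^sub>0 U" "smooth_on U G\<^sub>0" "smooth_on (G\<^sub>0 ` U) (inv_into U G\<^sub>0)"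
    "\<And>x. x \<in> U \<Longrightarrow> 0 < det (matrix (frechet_derivative G\<^sub>0 (at x)))"
    using diffeo by (simp_all add: oriented_diffeo_def)
qed

private lemma remainder:
  obtains A where "0 \<le> A"
    "\<forall>\<^sub>F h in at 0 within \<I>. (\<forall>x\<in>U. norm (G h x - G\<^sub>0 x) \<le> A * h) \<and>
       (\<forall>S x y. convex S \<and> S \<subseteq> U \<and> x \<in> S \<and> y \<in> S \<longrightarrow>
          norm ((G h x - G\<^sub>0 x) - (G h y - G\<^sub>0 y)) \<le> A * h * norm (x - y))"
proof -
  have "\<exists>g. g 0 = G\<^sub>0 \<and> smooth_expansion \<I> U G g"
    using chart unfolding asymptotic_chart_def by (elim conjE)
  then obtain g where g: "g 0 = G\<^sub>0" "smooth_expansion \<I> U G g"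
    by blast
  show thesis
    by (rule smooth_expansion_remainder[OF basic(1) g(2), unfolded g(1)]) (rule that)
qed

text \<open>Two labels of the same point \<open>t\<close> give points \<open>hk\<close> and \<open>hl\<close> at distance \<open>O(h)\<close> of
  \<open>G\<^sub>0\<^sup>-\<^sup>1(t)\<close>, hence in a ball inside \<open>U\<close> on which \<open>G h\<close> is a small Lipschitz perturbation of the
  diffeomorphism \<open>G\<^sub>0\<close>. As their images agree up to \<open>O(h\<^sup>2)\<close>, so do \<open>hk\<close> and \<open>hl\<close>; but distinct
  points of \<open>h\<int>\<^sup>n\<close> are at distance at least \<open>h\<close>. All constants are uniform in \<open>t\<close>, because the closure
  of \<open>B\<close> is a compact subset of \<open>G\<^sub>0 ` U\<close>.\<close>

lemma label_localization_and_uniqueness: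
  obtains A where "0 \<le> A"
    "\<forall>\<^sub>F h in at 0 within \<I>. \<forall>t\<in>B. \<forall>k. is_label U G C h t k \<longrightarrow>
       norm (scaled h k - inv_into U G\<^sub>0 t) \<le> A * h \<and> (\<forall>l. is_label U G C h t l \<longrightarrow> k = l)"
proof -
  let ?\<psi> = "inv_into U G\<^sub>0"
  have compB: "compact (closure B)"
    using basic(3) by simp
  obtain \<rho> where \<rho>: "0 < \<rho>" "compact (\<Union>x\<in>closure B. cball x \<rho>)" "(\<Union>x\<in>closure B. cball x \<rho>) \<subseteq> G\<^sub>0 ` U"
    using compact_thickening[OF compB basic(6,10)] .
  obtain D where D: "0 \<le> D" "\<And>S x y. \<lbrakk>convex S; S \<subseteq> (\<Union>x\<in>closure B. cball x \<rho>); x \<in> S; y \<in> S\<rbrakk> \<Longrightarrow>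
      norm (?\<psi> x - ?\<psi> y) \<le> D * norm (x - y)"
    by (rule smooth_on_Lipschitz_compact[OF basic(9) \<rho>(2,3)]) blast
  have cont: "continuous_on (closure B) ?\<psi>"
    using smooth_on_continuous_on[OF basic(9)] basic(10) by (rule continuous_on_subset)
  have \<psi>B: "?\<psi> ` closure B \<subseteq> U"
    using basic(10) by (blast intro: inv_into_into)
  obtain r where r0: "0 < r" and "compact (\<Union>x\<in>?\<psi> ` closure B. cball x r)"
    and rU: "(\<Union>x\<in>?\<psi> ` closure B. cball x r) \<subseteq> U"
    using compact_thickening[OF compact_continuous_image[OF cont compB] basic(5) \<psi>B] .
  note r = r0 rU
  obtain A where A: "0 \<le> A"
    "\<forall>\<^sub>F h in at 0 within \<I>. (\<forall>x\<in>U. norm (G h x - G\<^sub>0 x) \<le> A * h) \<and>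
       (\<forall>S x y. convex S \<and> S \<subseteq> U \<and> x \<in> S \<and> y \<in> S \<longrightarrow>
          norm ((G h x - G\<^sub>0 x) - (G h y - G\<^sub>0 y)) \<le> A * h * norm (x - y))"
    using remainder .
  (* Distance of G0(hk) to t: the label error with N = 1, plus the remainder. *)
  define A' where "A' = \<bar>C 1\<bar> + A"
  have "0 \<le> A'"
    using A(1) by (simp add: A'_def)
  (* In this order: G0(hk) is in the ball around t on which the inverse of G0 is Lipschitz; hk is in
     the ball where the remainder is controlled; the remainder can be absorbed; the distance of hk
     and hl is less than the mesh size. *)
  have "\<forall>\<^sub>F h in at 0 within \<I>. A' * h < \<rho>" "\<forall>\<^sub>F h in at 0 within \<I>. D * A' * h < r"
    "\<forall>\<^sub>F h in at 0 within \<I>. D * A * h < 1 / 2" "\<forall>\<^sub>F h in at 0 within \<I>. 4 * D * \<bar>C 2\<bar> * h < 1"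
    by (rule eventually_mult_less_at_0, use \<rho>(1) r(1) in simp)+
  with A(2) eventually_in_at_0_within
  have "\<forall>\<^sub>F h in at 0 within \<I>. \<forall>t\<in>B. \<forall>k. is_label U G C h t k \<longrightarrow>
       norm (scaled h k - ?\<psi> t) \<le> D * A' * h \<and> (\<forall>l. is_label U G C h t l \<longrightarrow> k = l)"
  proof eventually_elim
    case (elim h)
    then have h: "h > 0" "h \<in> \<I>"
      using basic(1) by auto
    show ?case
    proof (intro ballI)
      fix t assume "t \<in> B"
      then have t: "t \<in> closure B"
        using closure_subset by blast
      have ball_\<rho>: "cball t \<rho> \<subseteq> (\<Union>x\<in>closure B. cball x \<rho>)"
        using t by blast
      have ball_r: "cball (?\<psi> t) r \<subseteq> U"
        using t r(2) by blast
      have near: "G\<^sub>0 (scaled h k) \<in> cball t \<rho>" "norm (scaled h k - ?\<psi> t) \<le> D * A' * h"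
        "scaled h k \<in> U" "norm (t - G h (scaled h k)) \<le> \<bar>C 2\<bar> * h ^ 2"
        if k: "is_label U G C h t k" for k
      proof -
        let ?x = "scaled h k"
        show x: "?x \<in> U"
          using k by (simp add: is_label_def)
        have "norm (t - G h ?x) \<le> C N * h ^ N" for N
          using k by (simp add: is_label_def)
        moreover have "C N * h ^ N \<le> \<bar>C N\<bar> * h ^ N" for N
          using h(1) by (intro mult_right_mono) auto
        ultimately have k': "norm (t - G h ?x) \<le> \<bar>C N\<bar> * h ^ N" for N
          using order_trans by blast
        show "norm (t - G h ?x) \<le> \<bar>C 2\<bar> * h ^ 2"
          by (rule k')
        have "norm (t - G\<^sub>0 ?x) \<le> norm (t - G h ?x) + norm (G h ?x - G\<^sub>0 ?x)"
          using norm_triangle_ineq[of "t - G h ?x" "G h ?x - G\<^sub>0 ?x"] by simp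
        also have "\<dots> \<le> \<bar>C 1\<bar> * h + A * h"
          using k'[of 1] elim(1) x by (intro add_mono) auto
        finally have G\<^sub>0: "norm (G\<^sub>0 ?x - t) \<le> A' * h"
          by (simp add: A'_def algebra_simps norm_minus_commute)
        then show mem: "G\<^sub>0 ?x \<in> cball t \<rho>"
          using elim(3) by (simp add: dist_norm norm_minus_commute)
        have "norm (?x - ?\<psi> t) = norm (?\<psi> (G\<^sub>0 ?x) - ?\<psi> t)"
          using basic(7) x by simp
        also have "\<dots> \<le> D * norm (G\<^sub>0 ?x - t)"
          using D(2)[OF convex_cball ball_\<rho> mem] \<rho>(1) by simp
        also have "\<dots> \<le> D * (A' * h)"
          using G\<^sub>0 D(1) by (rule mult_left_mono)
        finally show "norm (?x - ?\<psi> t) \<le> D * A' * h"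
          by (simp add: mult.assoc)
      qed
      have "k = l" if k: "is_label U G C h t k" and l: "is_label U G C h t l" for k l
      proof -
        let ?x = "scaled h k" and ?y = "scaled h l"
        have xy: "?x \<in> cball (?\<psi> t) r" "?y \<in> cball (?\<psi> t) r"
          using near(2)[OF k] near(2)[OF l] elim(4) by (auto simp: dist_norm norm_minus_commute)
        have "G\<^sub>0 ?x - G\<^sub>0 ?y = (t - G h ?y) - (t - G h ?x) - ((G h ?x - G\<^sub>0 ?x) - (G h ?y - G\<^sub>0 ?y))"
          by simp
        then have "norm (G\<^sub>0 ?x - G\<^sub>0 ?y) =
            norm ((t - G h ?y) - (t - G h ?x) - ((G h ?x - G\<^sub>0 ?x) - (G h ?y - G\<^sub>0 ?y)))"
          by (rule arg_cong)
        also have "\<dots> \<le> norm (t - G h ?y) + norm (t - G h ?x)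
            + norm ((G h ?x - G\<^sub>0 ?x) - (G h ?y - G\<^sub>0 ?y))"
          using norm_triangle_ineq4[of "(t - G h ?y) - (t - G h ?x)" "(G h ?x - G\<^sub>0 ?x) - (G h ?y - G\<^sub>0 ?y)"]
            norm_triangle_ineq4[of "t - G h ?y" "t - G h ?x"] by linarith
        also have "\<dots> \<le> \<bar>C 2\<bar> * h ^ 2 + \<bar>C 2\<bar> * h ^ 2 + A * h * norm (?x - ?y)"
        proof (intro add_mono near(4) k l)
          show "norm ((G h ?x - G\<^sub>0 ?x) - (G h ?y - G\<^sub>0 ?y)) \<le> A * h * norm (?x - ?y)"
            using elim(1) ball_r xy convex_cball by blast
        qed
        finally have G\<^sub>0: "norm (G\<^sub>0 ?x - G\<^sub>0 ?y) \<le> 2 * \<bar>C 2\<bar> * h ^ 2 + A * h * norm (?x - ?y)"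
          by simp
        have "norm (?x - ?y) = norm (?\<psi> (G\<^sub>0 ?x) - ?\<psi> (G\<^sub>0 ?y))"
          using basic(7) near(3)[OF k] near(3)[OF l] by simp
        also have "\<dots> \<le> D * norm (G\<^sub>0 ?x - G\<^sub>0 ?y)"
          using D(2)[OF convex_cball ball_\<rho> near(1)[OF k] near(1)[OF l]] .
        also have "\<dots> \<le> D * (2 * \<bar>C 2\<bar> * h ^ 2 + A * h * norm (?x - ?y))"
          using G\<^sub>0 D(1) by (rule mult_left_mono)
        also have "\<dots> = 2 * D * \<bar>C 2\<bar> * h ^ 2 + (D * A * h) * norm (?x - ?y)"
          by (simp add: algebra_simps)
        also have "\<dots> \<le> 2 * D * \<bar>C 2\<bar> * h ^ 2 + 1 / 2 * norm (?x - ?y)"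
          using elim(5) by (intro add_left_mono mult_right_mono) auto
        finally have "norm (?x - ?y) \<le> (4 * D * \<bar>C 2\<bar> * h) * h"
          by (simp add: power2_eq_square)
        also have "\<dots> < 1 * h"
          using elim(6) h(1) by (rule mult_strict_right_mono)
        finally show ?thesis
          using scaled_eqI[OF h(1)] by simp
      qed
      then show "\<forall>k. is_label U G C h t k \<longrightarrow>
         norm (scaled h k - ?\<psi> t) \<le> D * A' * h \<and> (\<forall>l. is_label U G C h t l \<longrightarrow> k = l)"
        using near(2) by blast
    qed
  qed
  then show thesis
    using that[of "D * A'"] D(1) \<open>0 \<le> A'\<close> by simp
qed

text \<open>Injectivity of the labelling is where the separation of the lattice enters: two points with the
  same label are \<open>O(h\<^sup>N)\<close>-close for all \<open>N\<close>, so \<open>O(h\<^sup>N\<^sup>+\<^sup>1)\<close> is less than a separation of order \<open>h\<^sup>N\<close>.\<close>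

lemma good_label_bijective:
  "\<forall>\<^sub>F h in at 0 within \<I>. \<forall>t\<in>L h. is_label U G C h t (good_label U G C h t) \<and>
     (\<forall>k. is_label U G C h t k \<longrightarrow>
        good_label U G C h t = k \<and> the_inv_into (L h) (good_label U G C h) k = t)"
proof -
  obtain A where A: "\<forall>\<^sub>F h in at 0 within \<I>. \<forall>t\<in>B. \<forall>k. is_label U G C h t k \<longrightarrow>
       norm (scaled h k - inv_into U G\<^sub>0 t) \<le> A * h \<and> (\<forall>l. is_label U G C h t l \<longrightarrow> k = l)"
    using label_localization_and_uniqueness .
  have "\<exists>h\<^sub>1>0. \<exists>\<epsilon>>0. \<exists>N::nat. 1 \<le> N \<and> (\<forall>h\<in>\<I> \<inter> {0<..h\<^sub>1}. \<forall>s\<in>L h. \<forall>t\<in>L h. s \<noteq> t \<longrightarrow> \<epsilon> * h ^ N \<le> dist s t)"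
    using lattice unfolding asymptotic_lattice_def by (elim conjE)
  then obtain h\<^sub>1 \<epsilon> N where "h\<^sub>1 > 0" "\<epsilon> > 0"
    "\<forall>h\<in>\<I> \<inter> {0<..h\<^sub>1}. \<forall>s\<in>L h. \<forall>t\<in>L h. s \<noteq> t \<longrightarrow> \<epsilon> * h ^ N \<le> dist s t"
    by blast
  then have "\<forall>\<^sub>F h in at 0 within \<I>. \<forall>s\<in>L h. \<forall>t\<in>L h. s \<noteq> t \<longrightarrow> \<epsilon> * h ^ N \<le> dist s t"
    unfolding eventually_at_0_within_iff[OF basic(1)] by blast
  moreover have "\<forall>\<^sub>F h in at 0 within \<I>. 2 * C (Suc N) * h < \<epsilon>"
    using \<open>\<epsilon> > 0\<close> by (rule eventually_mult_less_at_0)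
  ultimately show ?thesis
    using A eventually_in_at_0_within
  proof eventually_elim
    case (elim h)
    then have h: "h > 0" "h \<in> \<I>"
      using basic(1) by auto
    have ex: "\<exists>k. is_label U G C h t k" if "t \<in> L h" for t
      using chart h(2) that by (auto simp: asymptotic_chart_def)
    have uniq: "k = l" if "t \<in> L h" "is_label U G C h t k" "is_label U G C h t l" for t k l
      using elim(3) basic(4)[OF h(2)] that by blast
    have good: "is_label U G C h t (good_label U G C h t)" if "t \<in> L h" for t
      unfolding good_label_def using ex[OF that] uniq[OF that] by (metis theI)
    have inj: "inj_on (good_label U G C h) (L h)"
    proof (rule inj_onI, rule ccontr)
      fix s t assume st: "s \<in> L h" "t \<in> L h" "good_label U G C h s = good_label U G C h t" "s \<noteq> t"
      let ?x = "G h (scaled h (good_label U G C h t))"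
      have "norm (s - ?x) \<le> C (Suc N) * h ^ Suc N" "norm (t - ?x) \<le> C (Suc N) * h ^ Suc N"
        using good[OF st(1)] good[OF st(2)] st(3) unfolding is_label_def by metis+
      then have "dist s t \<le> 2 * C (Suc N) * h * h ^ N"
        using norm_triangle_ineq4[of "s - ?x" "t - ?x"] by (simp add: dist_norm)
      also have "\<dots> < \<epsilon> * h ^ N"
        using elim(2) h(1) by (intro mult_strict_right_mono) auto
      finally show False
        using elim(1) st by fastforce
    qed
    show ?case
    proof (intro ballI conjI allI impI)
      fix t k assume "t \<in> L h" and "is_label U G C h t k"
      then show k: "good_label U G C h t = k"
        using uniq good by blast
      show "the_inv_into (L h) (good_label U G C h) k = t"
        using the_inv_into_f_f[OF inj \<open>t \<in> L h\<close>] k by simp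
    qed (use good in blast)
  qed
qed

lemma is_label_error:
  assumes "0 < h" "is_label U G C h t k"
  shows "norm (t - G h (scaled h k)) \<le> \<bar>C 2\<bar> * h\<^sup>2"
proof -
  have "norm (t - G h (scaled h k)) \<le> C 2 * h\<^sup>2"
    using assms(2) by (simp add: is_label_def)
  also have "\<dots> \<le> \<bar>C 2\<bar> * h\<^sup>2"
    using assms(1) by (intro mult_right_mono) auto
  finally show ?thesis .
qed

text \<open>The heart of the matter: neighbouring joint eigenvalues differ by \<open>h\<close> times a column of the
  Jacobian matrix of \<open>G\<^sub>0\<close>, up to \<open>O(h\<^sup>2)\<close>. The error terms are those of the labels (with \<open>N = 2\<close>), of
  the remainder \<open>G h - G\<^sub>0\<close>, which is \<open>O(h)\<close>-Lipschitz, and of the linearization of \<open>G\<^sub>0\<close> at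
  \<open>G\<^sub>0\<^sup>-\<^sup>1(c)\<close>, which is at distance \<open>O(h)\<close> from \<open>hk\<close>.\<close>

lemma lattice_increments:
  assumes K: "compact K" "K \<subseteq> B" and "0 \<le> M"
  obtains D where "0 \<le> D"
    "\<forall>\<^sub>F h in at 0 within \<I>. \<forall>c\<in>K. \<forall>t\<in>L h. norm (t - c) \<le> M * h \<longrightarrow>
       (\<forall>j. norm (the_inv_into (L h) (good_label U G C h) (good_label U G C h t + axis j 1)
           - the_inv_into (L h) (good_label U G C h) (good_label U G C h t)
           - h *\<^sub>R frechet_derivative G\<^sub>0 (at (inv_into U G\<^sub>0 c)) (axis j 1)) \<le> D * h\<^sup>2)"
proof -
  let ?\<psi> = "inv_into U G\<^sub>0"
  have KB: "K \<subseteq> G\<^sub>0 ` U"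
    using K(2) basic(10) closure_subset by blast
  obtain A\<^sub>1 where A\<^sub>1: "0 \<le> A\<^sub>1"
    "\<forall>\<^sub>F h in at 0 within \<I>. \<forall>t\<in>B. \<forall>k. is_label U G C h t k \<longrightarrow>
       norm (scaled h k - ?\<psi> t) \<le> A\<^sub>1 * h \<and> (\<forall>l. is_label U G C h t l \<longrightarrow> k = l)"
    using label_localization_and_uniqueness .
  obtain A\<^sub>2 where A\<^sub>2: "0 \<le> A\<^sub>2"
    "\<forall>\<^sub>F h in at 0 within \<I>. (\<forall>x\<in>U. norm (G h x - G\<^sub>0 x) \<le> A\<^sub>2 * h) \<and>
       (\<forall>S x y. convex S \<and> S \<subseteq> U \<and> x \<in> S \<and> y \<in> S \<longrightarrow>
          norm ((G h x - G\<^sub>0 x) - (G h y - G\<^sub>0 y)) \<le> A\<^sub>2 * h * norm (x - y))"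
    using remainder .
  obtain \<rho> where \<rho>: "0 < \<rho>" "compact (\<Union>x\<in>K. cball x \<rho>)" "(\<Union>x\<in>K. cball x \<rho>) \<subseteq> G\<^sub>0 ` U"
    using compact_thickening[OF K(1) basic(6) KB] .
  obtain D\<^sub>1 where D\<^sub>1: "0 \<le> D\<^sub>1" "\<And>S x y. \<lbrakk>convex S; S \<subseteq> (\<Union>x\<in>K. cball x \<rho>); x \<in> S; y \<in> S\<rbrakk> \<Longrightarrow>
      norm (?\<psi> x - ?\<psi> y) \<le> D\<^sub>1 * norm (x - y)"
    by (rule smooth_on_Lipschitz_compact[OF basic(9) \<rho>(2,3)]) blast
  let ?U' = "U \<inter> G\<^sub>0 -` B"
  have cont: "continuous_on K ?\<psi>"
    using smooth_on_continuous_on[OF basic(9)] KB by (rule continuous_on_subset)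
  have \<psi>K: "?\<psi> ` K \<subseteq> ?U'"
  proof
    fix x assume "x \<in> ?\<psi> ` K"
    then obtain c where "c \<in> K" "x = ?\<psi> c"
      by blast
    moreover from this have "c \<in> G\<^sub>0 ` U" "c \<in> B"
      using KB K(2) by blast+
    ultimately show "x \<in> ?U'"
      using inv_into_into[of c G\<^sub>0 U] f_inv_into_f[of c G\<^sub>0 U] by auto
  qed
  have opU': "open ?U'"
    using smooth_on_continuous_on[OF basic(8)] basic(5,2) by (rule continuous_open_preimage)
  obtain r where r: "0 < r" "compact (\<Union>x\<in>?\<psi> ` K. cball x r)"
    "(\<Union>x\<in>?\<psi> ` K. cball x r) \<subseteq> ?U'"
    using compact_thickening[OF compact_continuous_image[OF cont K(1)] opU' \<psi>K] .
  then have rU: "(\<Union>x\<in>?\<psi> ` K. cball x r) \<subseteq> U"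
    by blast
  obtain D\<^sub>2 where D\<^sub>2: "0 \<le> D\<^sub>2"
    "\<And>a s x y. \<lbrakk>cball a s \<subseteq> (\<Union>x\<in>?\<psi> ` K. cball x r); x \<in> cball a s; y \<in> cball a s\<rbrakk> \<Longrightarrow>
       norm (G\<^sub>0 x - G\<^sub>0 y - frechet_derivative G\<^sub>0 (at a) (x - y)) \<le> D\<^sub>2 * s * norm (x - y)"
    by (rule smooth_on_linearization_compact[OF basic(8) r(2) rU]) blast
  (* The open set on which every lattice label has to be attained. *)
  let ?V = "\<Union>x\<in>?\<psi> ` K. ball x r"
  have "?V \<subseteq> (\<Union>x\<in>?\<psi> ` K. cball x r)"
    using ball_subset_cball by blast
  then have clV: "closure ?V \<subseteq> (\<Union>x\<in>?\<psi> ` K. cball x r)"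
    using r(2) by (intro closure_minimal compact_imp_closed)
  then have "compact (closure ?V)"
    using r(2) compact_Int_closed[of "\<Union>x\<in>?\<psi> ` K. cball x r" "closure ?V"]
    by (simp add: Int_absorb1)
  moreover have "closure ?V \<subseteq> {x \<in> U. G\<^sub>0 x \<in> B}"
    using clV r(3) by auto
  moreover have "open ?V"
    by auto
  ultimately have "\<exists>h\<^sub>1>0. \<forall>h\<in>\<I> \<inter> {0<..h\<^sub>1}. \<forall>k. scaled h k \<in> ?V \<longrightarrow> (\<exists>t\<in>L h. is_label U G C h t k)"
    using chart[unfolded asymptotic_chart_def] by (elim conjE) blast
  then have full: "\<forall>\<^sub>F h in at 0 within \<I>. \<forall>k. scaled h k \<in> ?V \<longrightarrow> (\<exists>t\<in>L h. is_label U G C h t k)"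
    unfolding eventually_at_0_within_iff[OF basic(1)] .
  (* E h bounds the distance of both hk and h(k + e_j) to the preimage of c: A1 comes from the
     label of t, D1 M from the distance of t and c, and 1 from the step to the neighbour. *)
  define E where "E = A\<^sub>1 + D\<^sub>1 * M + 1"
  have "0 \<le> E"
    using A\<^sub>1(1) D\<^sub>1(1) \<open>0 \<le> M\<close> by (simp add: E_def)
  define D where "D = 2 * \<bar>C 2\<bar> + A\<^sub>2 + D\<^sub>2 * E"
  have "\<forall>\<^sub>F h in at 0 within \<I>. M * h < \<rho>" "\<forall>\<^sub>F h in at 0 within \<I>. E * h < r"
    by (rule eventually_mult_less_at_0, use \<rho>(1) r(1) in simp)+
  with A\<^sub>1(2) A\<^sub>2(2) full good_label_bijective eventually_in_at_0_within
  have "\<forall>\<^sub>F h in at 0 within \<I>. \<forall>c\<in>K. \<forall>t\<in>L h. norm (t - c) \<le> M * h \<longrightarrow>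
       (\<forall>j. norm (the_inv_into (L h) (good_label U G C h) (good_label U G C h t + axis j 1)
           - the_inv_into (L h) (good_label U G C h) (good_label U G C h t)
           - h *\<^sub>R frechet_derivative G\<^sub>0 (at (?\<psi> c)) (axis j 1)) \<le> D * h\<^sup>2)"
  proof (eventually_elim, intro ballI impI allI)
    case (elim h)
    then have h: "h > 0" "h \<in> \<I>"
      using basic(1) by auto
    fix c t j assume c: "c \<in> K" and t: "t \<in> L h" and tc: "norm (t - c) \<le> M * h"
    let ?k = "good_label U G C h t" and ?a = "?\<psi> c"
    let ?x = "scaled h ?k" and ?y = "scaled h (?k + axis j 1)"
    have k: "is_label U G C h t ?k"
      using elim(4) t by blast
    have yx: "?y - ?x = h *\<^sub>R axis j 1" "norm (?y - ?x) = h"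
      using h(1) by (simp_all add: scaled_add_axis norm_axis_1)
    have "norm (?\<psi> t - ?a) \<le> D\<^sub>1 * norm (t - c)"
      by (rule D\<^sub>1(2)[of "cball c \<rho>"]) (use c tc elim(6) \<rho>(1) in \<open>auto simp: dist_norm norm_minus_commute\<close>)
    also have "\<dots> \<le> D\<^sub>1 * (M * h)"
      using tc D\<^sub>1(1) by (rule mult_left_mono)
    finally have "norm (?\<psi> t - ?a) \<le> D\<^sub>1 * (M * h)" .
    moreover have "norm (?x - ?\<psi> t) \<le> A\<^sub>1 * h"
      using elim(1) basic(4)[OF h(2)] t k by blast
    ultimately have x: "norm (?x - ?a) \<le> E * h - h"
      using norm_triangle_ineq[of "?x - ?\<psi> t" "?\<psi> t - ?a"] by (simp add: E_def algebra_simps)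
    then have y: "norm (?y - ?a) \<le> E * h"
      using norm_triangle_ineq[of "?y - ?x" "?x - ?a"] yx(2) by simp
    have xs: "?x \<in> cball ?a (E * h)" "?y \<in> cball ?a (E * h)"
      using x y h(1) by (auto simp: dist_norm norm_minus_commute)
    have sub: "cball ?a (E * h) \<subseteq> (\<Union>x\<in>?\<psi> ` K. cball x r)"
      using c elim(7) subset_cball[of "E * h" r ?a] by auto
    have "?y \<in> ball ?a r"
      using xs(2) elim(7) by simp
    then have "?y \<in> ?V"
      using c by blast
    then obtain s where s: "s \<in> L h" "is_label U G C h s (?k + axis j 1)"
      using elim(3) by blast
    have inv: "the_inv_into (L h) (good_label U G C h) ?k = t"
      "the_inv_into (L h) (good_label U G C h) (?k + axis j 1) = s"
      using elim(4) t k s by blast+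
    have Df: "frechet_derivative G\<^sub>0 (at ?a) (?y - ?x) = h *\<^sub>R frechet_derivative G\<^sub>0 (at ?a) (axis j 1)"
    proof -
      have "linear (frechet_derivative G\<^sub>0 (at ?a))"
        using has_derivative_linear[OF smooth_on_has_derivative[OF basic(8)]] \<psi>K c by blast
      then show ?thesis
        by (simp add: yx(1) linear_cmul)
    qed
    let ?lin = "G\<^sub>0 ?y - G\<^sub>0 ?x - frechet_derivative G\<^sub>0 (at ?a) (?y - ?x)"
    let ?rem = "(G h ?y - G\<^sub>0 ?y) - (G h ?x - G\<^sub>0 ?x)"
    have "s - t - h *\<^sub>R frechet_derivative G\<^sub>0 (at ?a) (axis j 1) =
        (s - G h ?y) - (t - G h ?x) + ?rem + ?lin"
      unfolding Df[symmetric] by simp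
    then have "norm (s - t - h *\<^sub>R frechet_derivative G\<^sub>0 (at ?a) (axis j 1)) =
        norm ((s - G h ?y) - (t - G h ?x) + ?rem + ?lin)"
      by (rule arg_cong)
    also have "\<dots> \<le> norm (s - G h ?y) + norm (t - G h ?x) + norm ?rem + norm ?lin"
      using norm_triangle_ineq[of "(s - G h ?y) - (t - G h ?x) + ?rem" ?lin]
        norm_triangle_ineq[of "(s - G h ?y) - (t - G h ?x)" ?rem]
        norm_triangle_ineq4[of "s - G h ?y" "t - G h ?x"] by linarith
    also have "\<dots> \<le> \<bar>C 2\<bar> * h\<^sup>2 + \<bar>C 2\<bar> * h\<^sup>2 + A\<^sub>2 * h * h + D\<^sub>2 * (E * h) * h"
    proof (intro add_mono is_label_error[OF h(1)] s(2) k)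
      have "cball ?a (E * h) \<subseteq> U"
        using sub rU by blast
      then have "norm ?rem \<le> A\<^sub>2 * h * norm (?y - ?x)"
        using elim(2) xs convex_cball by blast
      then show "norm ?rem \<le> A\<^sub>2 * h * h"
        by (simp only: yx(2))
      show "norm ?lin \<le> D\<^sub>2 * (E * h) * h"
        using D\<^sub>2(2)[OF sub xs(2,1)] by (simp only: yx(2))
    qed
    also have "\<dots> = D * h\<^sup>2"
      by (simp add: D_def power2_eq_square algebra_simps)
    finally show "norm (the_inv_into (L h) (good_label U G C h) (?k + axis j 1)
        - the_inv_into (L h) (good_label U G C h) ?k
        - h *\<^sub>R frechet_derivative G\<^sub>0 (at ?a) (axis j 1)) \<le> D * h\<^sup>2"
      unfolding inv .
  qed
  then show thesis
    using that[of D] A\<^sub>2(1) D\<^sub>2(1) \<open>0 \<le> E\<close> by (simp add: D_def)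
qed

text \<open>A row of the Jacobian matrix of \<open>G\<^sub>0\<close> cannot vanish; over a compact set this gives a positive
  lower bound.\<close>

lemma jacobian_row_nonzero:
  assumes "c \<in> G\<^sub>0 ` U"
  shows "(\<chi> j. frechet_derivative G\<^sub>0 (at (inv_into U G\<^sub>0 c)) (axis j 1) $ i) \<noteq> 0"
proof
  let ?J = "matrix (frechet_derivative G\<^sub>0 (at (inv_into U G\<^sub>0 c)))"
  assume "(\<chi> j. frechet_derivative G\<^sub>0 (at (inv_into U G\<^sub>0 c)) (axis j 1) $ i) = 0"
  then have "row i ?J = 0"
    by (simp add: row_def matrix_def vec_eq_iff)
  then have "det ?J = 0"
    by (rule det_zero_row)
  with basic(11)[OF inv_into_into[OF assms]] show False
    by simp
qed

lemma jacobian_row_lower_bound: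
  assumes K: "compact K" "K \<subseteq> B"
  obtains \<delta> where "0 < \<delta>"
    "\<And>c. c \<in> K \<Longrightarrow> \<delta> \<le> norm (\<chi> j. frechet_derivative G\<^sub>0 (at (inv_into U G\<^sub>0 c)) (axis j 1) $ i)"
proof (cases "K = {}")
  case False
  let ?w = "\<lambda>c. \<chi> j. frechet_derivative G\<^sub>0 (at (inv_into U G\<^sub>0 c)) (axis j 1) $ i"
  have KB: "K \<subseteq> G\<^sub>0 ` U"
    using K(2) basic(10) closure_subset by blast
  have "continuous_on K (\<lambda>c. frechet_derivative G\<^sub>0 (at (inv_into U G\<^sub>0 c)) (axis j 1))" for j
  proof (rule continuous_on_compose2[of U "\<lambda>x. frechet_derivative G\<^sub>0 (at x) (axis j 1)"])
    show "continuous_on U (\<lambda>x. frechet_derivative G\<^sub>0 (at x) (axis j 1))"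
      by (intro smooth_on_continuous_on smooth_on_frechet_derivative basic(8)) simp
    show "continuous_on K (inv_into U G\<^sub>0)"
      using smooth_on_continuous_on[OF basic(9)] KB by (rule continuous_on_subset)
  qed (use KB in \<open>auto intro: inv_into_into\<close>)
  then have "continuous_on K (\<lambda>c. norm (?w c))"
    by (intro continuous_intros continuous_on_norm)
  then obtain c where c: "c \<in> K" "\<And>d. d \<in> K \<Longrightarrow> norm (?w c) \<le> norm (?w d)"
    using continuous_attains_inf[OF K(1) False] by blast
  show thesis
    by (rule that[of "norm (?w c)"]) (use c KB jacobian_row_nonzero in auto)
next
  case True
  show thesis
    by (rule that[of 1]) (use True in auto)
qed

end

section \<open>Distances in projective space\<close>

lemma proj_point_scaleR:
  assumes "a \<noteq> 0"
  shows "proj_point (a *\<^sub>R v) = proj_point v"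
  unfolding proj_point_def span_singleton
proof (intro equalityI subsetI)
  fix x assume "x \<in> range (\<lambda>k. k *\<^sub>R v)"
  then obtain k where "x = (k / a) *\<^sub>R a *\<^sub>R v"
    using assms by auto
  then show "x \<in> range (\<lambda>k. k *\<^sub>R a *\<^sub>R v)"
    by blast
qed auto

lemma sgn_in_proj_point: "sgn v \<in> proj_point v"
  by (simp add: proj_point_def sgn_div_norm span_base span_mul)

text \<open>The infimum is estimated by the distance of the normalized vectors; it is multiplied by \<open>norm w\<close>
  first, which reduces the claim to \<open>\<bar>norm w - norm u\<bar> \<le> norm (u - w)\<close>.\<close>

lemma proj_dist_le:
  assumes "u \<noteq> 0" "w \<noteq> 0"
  shows "proj_dist (proj_point u) (proj_point w) \<le> 2 * norm (u - w) / norm w"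
proof -
  have "norm w * dist (sgn u) (sgn w) = norm (norm w *\<^sub>R (sgn u - sgn w))"
    by (simp add: dist_norm)
  also have "norm w *\<^sub>R (sgn u - sgn w) = (norm w - norm u) *\<^sub>R sgn u + (u - w)"
  proof -
    have polar: "norm u *\<^sub>R sgn u = u" "norm w *\<^sub>R sgn w = w"
      using assms by (simp_all add: sgn_div_norm)
    show ?thesis
      by (simp only: scaleR_diff_left scaleR_diff_right polar) simp
  qed
  also have "norm \<dots> \<le> norm ((norm w - norm u) *\<^sub>R sgn u) + norm (u - w)"
    by (rule norm_triangle_ineq)
  also have "norm ((norm w - norm u) *\<^sub>R sgn u) \<le> norm (u - w)"
    using norm_triangle_ineq3[of u w] assms(1) by (simp add: norm_sgn abs_minus_commute)
  finally have "dist (sgn u) (sgn w) \<le> 2 * norm (u - w) / norm w"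
    using assms(2) by (simp add: pos_le_divide_eq mult.commute)
  moreover have "proj_dist (proj_point u) (proj_point w) \<le> dist (sgn u) (sgn w)"
    unfolding proj_dist_def
  proof (rule cInf_lower)
    have "norm (sgn u) = 1" "norm (sgn w) = 1"
      using assms by (simp_all add: norm_sgn)
    then show "dist (sgn u) (sgn w) \<in> {dist u' w' | u' w'.
        u' \<in> proj_point u \<and> w' \<in> proj_point w \<and> norm u' = 1 \<and> norm w' = 1}"
      using sgn_in_proj_point[of u] sgn_in_proj_point[of w] by blast
  qed (auto intro!: bdd_belowI[of _ 0])
  ultimately show ?thesis
    by linarith
qed

lemma proj_dist_nonneg:
  fixes L L' :: "(real^'n::finite) set"
  assumes "L \<in> proj_space" "L' \<in> proj_space"
  shows "0 \<le> proj_dist L L'"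
proof -
  have "\<exists>u\<in>K. norm u = 1" if K: "K \<in> proj_space" for K :: "(real^'n) set"
  proof -
    obtain v where "K = proj_point v" "v \<noteq> 0"
      using K by (auto simp: proj_space_def)
    then show ?thesis
      using sgn_in_proj_point[of v] by (intro bexI[of _ "sgn v"]) (simp_all add: norm_sgn)
  qed
  then obtain u v where "u \<in> L" "norm u = 1" "v \<in> L'" "norm v = 1"
    using assms by blast
  then show ?thesis
    unfolding proj_dist_def by (intro cInf_greatest) auto
qed

section \<open>The quantum rotation number\<close>

text \<open>The last components of the lattice increments form the vector \<open>h w + O(h\<^sup>2)\<close>, where \<open>w\<close> is the
  last row of the Jacobian matrix of \<open>G\<^sub>0\<close>. Its direction is that of \<open>w\<close> up to \<open>O(h)\<close>, since \<open>w\<close> is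
  bounded from below on compact sets.\<close>

lemma quantum_rotation_number_near_jacobian_row:
  fixes L :: "real \<Rightarrow> (real, 'n::{finite,linorder}) vec set"
  assumes lattice: "asymptotic_lattice L \<I> B"
    and chart: "asymptotic_chart L \<I> B U G G\<^sub>0 C"
    and K: "compact K" "K \<subseteq> B" and "0 \<le> M"
  obtains M' where "\<forall>\<^sub>F h in at 0 within \<I>. \<forall>c\<in>K. \<forall>t\<in>L h. norm (t - c) \<le> M * h \<longrightarrow>
      quantum_rotation_number L U G C h (good_label U G C h t) \<in> proj_space \<and>
      proj_dist (quantum_rotation_number L U G C h (good_label U G C h t))
        (proj_point (\<chi> j. frechet_derivative G\<^sub>0 (at (inv_into U G\<^sub>0 c)) (axis j 1) $ last_index)) \<le> M' * h"
proof -
  let ?w = "\<lambda>c. \<chi> j. frechet_derivative G\<^sub>0 (at (inv_into U G\<^sub>0 c)) (axis j 1) $ last_index"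
  obtain D where D: "0 \<le> D"
    "\<forall>\<^sub>F h in at 0 within \<I>. \<forall>c\<in>K. \<forall>t\<in>L h. norm (t - c) \<le> M * h \<longrightarrow>
       (\<forall>j. norm (the_inv_into (L h) (good_label U G C h) (good_label U G C h t + axis j 1)
           - the_inv_into (L h) (good_label U G C h) (good_label U G C h t)
           - h *\<^sub>R frechet_derivative G\<^sub>0 (at (inv_into U G\<^sub>0 c)) (axis j 1)) \<le> D * h\<^sup>2)"
    using lattice_increments[OF lattice chart K \<open>0 \<le> M\<close>] .
  obtain \<delta> where \<delta>: "0 < \<delta>" "\<And>c. c \<in> K \<Longrightarrow> \<delta> \<le> norm (?w c)"
    by (rule jacobian_row_lower_bound[OF lattice chart K]) blast
  define D' where "D' = real CARD('n) * D"
  have "0 \<le> D'"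
    using D(1) by (simp add: D'_def)
  have pos: "\<I> \<subseteq> {0<..}"
    using lattice unfolding asymptotic_lattice_def by (elim conjE)
  have "\<forall>\<^sub>F h in at 0 within \<I>. D' * h < \<delta>"
    using \<delta>(1) by (rule eventually_mult_less_at_0)
  with D(2) eventually_in_at_0_within
  have "\<forall>\<^sub>F h in at 0 within \<I>. \<forall>c\<in>K. \<forall>t\<in>L h. norm (t - c) \<le> M * h \<longrightarrow>
      quantum_rotation_number L U G C h (good_label U G C h t) \<in> proj_space \<and>
      proj_dist (quantum_rotation_number L U G C h (good_label U G C h t)) (proj_point (?w c))
        \<le> 2 * D' / \<delta> * h"
  proof (eventually_elim, intro ballI impI)
    case (elim h)
    fix c t assume c: "c \<in> K" and t: "t \<in> L h" and tc: "norm (t - c) \<le> M * h"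
    have h: "0 < h"
      using elim(2) pos by auto
    let ?k = "good_label U G C h t"
    define u where "u = (\<chi> j. labelled_eigenvalue L U G C h (?k + axis j 1)
      - labelled_eigenvalue L U G C h ?k)"
    have Q: "quantum_rotation_number L U G C h ?k = proj_point u"
      by (simp add: quantum_rotation_number_def u_def)
    have "norm (u - h *\<^sub>R ?w c) \<le> (\<Sum>j\<in>UNIV. \<bar>(u - h *\<^sub>R ?w c) $ j\<bar>)"
      by (rule norm_le_l1_cart)
    also have "\<dots> \<le> (\<Sum>j\<in>(UNIV :: 'n set). D * h\<^sup>2)"
    proof (rule sum_mono)
      fix j :: 'n
      let ?v = "the_inv_into (L h) (good_label U G C h) (?k + axis j 1)
        - the_inv_into (L h) (good_label U G C h) ?k
        - h *\<^sub>R frechet_derivative G\<^sub>0 (at (inv_into U G\<^sub>0 c)) (axis j 1)"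
      have "(u - h *\<^sub>R ?w c) $ j = ?v $ last_index"
        by (simp add: u_def labelled_eigenvalue_def)
      moreover have "norm ?v \<le> D * h\<^sup>2"
        using elim(1) c t tc by blast
      ultimately show "\<bar>(u - h *\<^sub>R ?w c) $ j\<bar> \<le> D * h\<^sup>2"
        using component_le_norm_cart[of ?v last_index] by linarith
    qed
    also have "\<dots> = D' * h\<^sup>2"
      by (simp add: D'_def)
    finally have near: "norm (u - h *\<^sub>R ?w c) \<le> D' * h\<^sup>2" .
    have lower: "\<delta> * h \<le> norm (h *\<^sub>R ?w c)"
      using \<delta>(2)[OF c] h by (simp add: mult.commute)
    have "D' * h\<^sup>2 < \<delta> * h"
      using mult_strict_right_mono[OF elim(3) h] by (simp add: power2_eq_square mult.assoc)
    then have "u \<noteq> 0"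
      using near lower by auto
    moreover have w: "h *\<^sub>R ?w c \<noteq> 0"
      using lower mult_pos_pos[OF \<delta>(1) h] by (metis norm_zero not_le)
    ultimately have "proj_dist (proj_point u) (proj_point (h *\<^sub>R ?w c)) \<le>
        2 * norm (u - h *\<^sub>R ?w c) / norm (h *\<^sub>R ?w c)"
      by (rule proj_dist_le)
    also have "\<dots> \<le> 2 * (D' * h\<^sup>2) / (\<delta> * h)"
      using near lower \<delta>(1) h \<open>0 \<le> D'\<close> by (intro frac_le) auto
    also have "\<dots> = 2 * D' / \<delta> * h"
      using h by (simp add: power2_eq_square)
    finally have "proj_dist (proj_point u) (proj_point (?w c)) \<le> 2 * D' / \<delta> * h"
      using proj_point_scaleR[of h "?w c"] h by simp
    then show "quantum_rotation_number L U G C h ?k \<in> proj_space \<and>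
        proj_dist (quantum_rotation_number L U G C h ?k) (proj_point (?w c)) \<le> 2 * D' / \<delta> * h"
      using \<open>u \<noteq> 0\<close> unfolding Q proj_space_def by blast
  qed
  then show thesis
    by (rule that)
qed

theorem theorem3p30:
  fixes \<A> :: "('x::t2_space, 'n::{finite,linorder}) atlas"
    and \<mu> :: "'x measure"
    and s :: "'n symbol_order"
    and h\<^sub>0 :: real
    and P :: "real \<Rightarrow> 'n \<Rightarrow> 'x operator"
    and F :: "('x, 'n) phase_point \<Rightarrow> (real, 'n) vec"
    and L :: "real \<Rightarrow> (real, 'n) vec set"
    and \<I> :: "real set"
    and B U :: "(real, 'n) vec set"
    and G :: "real \<Rightarrow> (real, 'n) vec \<Rightarrow> (real, 'n) vec"
    and G\<^sub>0 :: "(real, 'n) vec \<Rightarrow> (real, 'n) vec"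
    and C :: "nat \<Rightarrow> real"
    and H :: "('x, 'n) phase_point \<Rightarrow> real"
    and I :: "('x, 'n) phase_point \<Rightarrow> (real, 'n) vec"
    and R :: "(real, 'n) vec set"
  assumes qis: "quantum_integrable_system \<A> \<mu> s h\<^sub>0 P F"
    and H: "H = (\<lambda>p. F p $ last_index)"
    and h_range: "\<I> \<subseteq> {0<..h\<^sub>0}"
    and L: "L = (\<lambda>h. joint_spectrum \<mu> (P h) \<inter> B)"
    and lattice: "asymptotic_lattice L \<I> B"
    and chart: "asymptotic_chart L \<I> B U G G\<^sub>0 C"
    and I: "I = inv_into U G\<^sub>0 \<circ> F"
    and R: "R = {c \<in> B. c \<in> F ` cotangent \<A> \<and> regular_value \<A> F c \<and>
                        connectedin (ct_topology \<A>) (fiber \<A> F c)}"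
  shows
    "(\<forall>c\<in>R. \<forall>lam :: real \<Rightarrow> (real, 'n) vec.
        (\<forall>\<^sub>F h in at 0 within \<I>. lam h \<in> joint_spectrum \<mu> (P h)) \<and>
        (\<lambda>h. norm (lam h - c)) \<in> O[at 0 within \<I>](\<lambda>h. h) \<longrightarrow>
        classical_rotation_number \<A> H I (fiber \<A> F c) \<in> proj_space \<and>
        (\<forall>\<^sub>F h in at 0 within \<I>.
           quantum_rotation_number L U G C h (good_label U G C h (lam h)) \<in> proj_space) \<and>
        (\<lambda>h. proj_dist (quantum_rotation_number L U G C h (good_label U G C h (lam h)))
                       (classical_rotation_number \<A> H I (fiber \<A> F c)))
          \<in> O[at 0 within \<I>](\<lambda>h. h)) \<and>
     (\<forall>K M. compact K \<and> K \<subseteq> R \<longrightarrow>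
        (\<exists>M'. \<exists>h\<^sub>1>0. \<forall>h\<in>\<I> \<inter> {0<..h\<^sub>1}. \<forall>c\<in>K. \<forall>t\<in>joint_spectrum \<mu> (P h).
           norm (t - c) \<le> M * h \<longrightarrow>
           quantum_rotation_number L U G C h (good_label U G C h t) \<in> proj_space \<and>
           proj_dist (quantum_rotation_number L U G C h (good_label U G C h t))
                     (classical_rotation_number \<A> H I (fiber \<A> F c)) \<le> M' * h))"
proof -
  let ?Cl = "\<lambda>c. classical_rotation_number \<A> H I (fiber \<A> F c)"
  let ?Q = "\<lambda>h t. quantum_rotation_number L U G C h (good_label U G C h t)"
  let ?w = "\<lambda>c. \<chi> j. frechet_derivative G\<^sub>0 (at (inv_into U G\<^sub>0 c)) (axis j 1) $ last_index"
  have pos: "\<I> \<subseteq> {0<..}"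
    using h_range by auto
  have B: "open B" "R \<subseteq> B"
    using lattice R by (auto simp only: asymptotic_lattice_def)
  have diffeo: "oriented_diffeo U G\<^sub>0" and clB: "closure B \<subseteq> G\<^sub>0 ` U"
    using chart unfolding asymptotic_chart_def by - (elim conjE, assumption)+
  have F: "ct_smooth \<A> F" "proper_map (ct_topology \<A>) euclidean F" "smooth_atlas \<A>"
    using qis smooth_atlas_of_admissible_space
    unfolding quantum_integrable_system_def classical_integrable_system_def by blast+
  have RU: "c \<in> G\<^sub>0 ` U" if "c \<in> R" for c
    using that B(2) clB closure_subset by blast
  have classical: "?Cl c = proj_point (?w c)" if "c \<in> R" for c
    unfolding H I
    by (rule classical_rotation_number_eq[OF F(3,1,2) diffeo RU[OF that]]) (use that R in auto)
  have classical_in: "?Cl c \<in> proj_space" if "c \<in> R" for c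
    unfolding classical[OF that] proj_space_def
    using jacobian_row_nonzero[OF lattice chart RU[OF that]] by blast
  have uniform: "\<exists>M'. \<forall>\<^sub>F h in at 0 within \<I>. \<forall>c\<in>K. \<forall>t\<in>joint_spectrum \<mu> (P h).
      norm (t - c) \<le> M * h \<longrightarrow> ?Q h t \<in> proj_space \<and> proj_dist (?Q h t) (?Cl c) \<le> M' * h"
    if K: "compact K" "K \<subseteq> R" for K M
  proof -
    have KB: "K \<subseteq> B"
      using K(2) B(2) by blast
    obtain r where r: "0 < r" "(\<Union>c\<in>K. cball c r) \<subseteq> B"
      using compact_subset_open_imp_cball_epsilon_subset[OF K(1) B(1) KB] .
    obtain M' where M': "\<forall>\<^sub>F h in at 0 within \<I>. \<forall>c\<in>K. \<forall>t\<in>L h. norm (t - c) \<le> \<bar>M\<bar> * h \<longrightarrow>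
        ?Q h t \<in> proj_space \<and> proj_dist (?Q h t) (proj_point (?w c)) \<le> M' * h"
      using quantum_rotation_number_near_jacobian_row[OF lattice chart K(1) KB abs_ge_zero] .
    have "\<forall>\<^sub>F h in at 0 within \<I>. M * h < r"
      using r(1) by (rule eventually_mult_less_at_0)
    with M' eventually_in_at_0_within
    have "\<forall>\<^sub>F h in at 0 within \<I>. \<forall>c\<in>K. \<forall>t\<in>joint_spectrum \<mu> (P h).
      norm (t - c) \<le> M * h \<longrightarrow> ?Q h t \<in> proj_space \<and> proj_dist (?Q h t) (?Cl c) \<le> M' * h"
    proof (eventually_elim, intro ballI impI)
      case (elim h)
      fix c t assume c: "c \<in> K" and t: "t \<in> joint_spectrum \<mu> (P h)" and tc: "norm (t - c) \<le> M * h"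
      have "t \<in> cball c r"
        using tc elim(3) by (simp add: dist_norm norm_minus_commute)
      then have "t \<in> L h"
        using r(2) c t unfolding L by blast
      moreover have "M * h \<le> \<bar>M\<bar> * h"
        using elim(2) pos by (intro mult_right_mono) auto
      ultimately have "?Q h t \<in> proj_space \<and> proj_dist (?Q h t) (proj_point (?w c)) \<le> M' * h"
        using elim(1) c tc order_trans by blast
      then show "?Q h t \<in> proj_space \<and> proj_dist (?Q h t) (?Cl c) \<le> M' * h"
        using classical[of c] c K(2) by (simp only: subsetD)
    qed
    then show ?thesis
      by (rule exI[of _ M'])
  qed
  show ?thesis
  proof (intro conjI ballI allI impI)
    fix c and lam :: "real \<Rightarrow> (real, 'n) vec"
    assume c: "c \<in> R"
      and lam: "(\<forall>\<^sub>F h in at 0 within \<I>. lam h \<in> joint_spectrum \<mu> (P h)) \<and>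
        (\<lambda>h. norm (lam h - c)) \<in> O[at 0 within \<I>](\<lambda>h. h)"
    show "?Cl c \<in> proj_space"
      using c by (rule classical_in)
    obtain M where M: "\<forall>\<^sub>F h in at 0 within \<I>. norm (norm (lam h - c)) \<le> M * norm h"
      using landau_o.bigE[OF conjunct2[OF lam]] by metis
    (* The bound for a single c is the uniform one for the compact set {c}. *)
    have "compact {c}" "{c} \<subseteq> R"
      using c by auto
    from uniform[OF this, of M] obtain M' where
      "\<forall>\<^sub>F h in at 0 within \<I>. \<forall>c\<in>{c}. \<forall>t\<in>joint_spectrum \<mu> (P h). norm (t - c) \<le> M * h \<longrightarrow>
        ?Q h t \<in> proj_space \<and> proj_dist (?Q h t) (?Cl c) \<le> M' * h"
      by blast
    with conjunct1[OF lam] M eventually_in_at_0_within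
    have ev: "\<forall>\<^sub>F h in at 0 within \<I>. 0 < h \<and> ?Q h (lam h) \<in> proj_space \<and>
        proj_dist (?Q h (lam h)) (?Cl c) \<le> M' * h"
    proof eventually_elim
      case (elim h)
      then have "0 < h"
        using pos by auto
      then have "norm (lam h - c) \<le> M * h"
        using elim(2) by simp
      with elim(1,4) \<open>0 < h\<close> show ?case
        by blast
    qed
    then show "\<forall>\<^sub>F h in at 0 within \<I>. ?Q h (lam h) \<in> proj_space"
      by (rule eventually_mono) blast
    from ev have "\<forall>\<^sub>F h in at 0 within \<I>. norm (proj_dist (?Q h (lam h)) (?Cl c)) \<le> M' * norm h"
    proof eventually_elim
      case (elim h)
      then have "0 \<le> proj_dist (?Q h (lam h)) (?Cl c)"
        using classical_in[OF c] by (blast intro: proj_dist_nonneg)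
      with elim show ?case
        by simp
    qed
    then show "(\<lambda>h. proj_dist (?Q h (lam h)) (?Cl c)) \<in> O[at 0 within \<I>](\<lambda>h. h)"
      by (rule bigoI)
  next
    fix K M assume "compact K \<and> K \<subseteq> R"
    then show "\<exists>M'. \<exists>h\<^sub>1>0. \<forall>h\<in>\<I> \<inter> {0<..h\<^sub>1}. \<forall>c\<in>K. \<forall>t\<in>joint_spectrum \<mu> (P h).
           norm (t - c) \<le> M * h \<longrightarrow> ?Q h t \<in> proj_space \<and> proj_dist (?Q h t) (?Cl c) \<le> M' * h"
      using uniform[of K M] unfolding eventually_at_0_within_iff[OF pos] by blast
  qed
qed

end
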